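(* Let $\mathcal{H}$ be a separable complex Hilbert space and let $T,L\in\mathcal{B}(\mathcal{H})$ be such that $T$ is invertible and $LT=TL$. Consider the set $$\mathcal{V}:=\{v\in\mathcal{H}: (\mathcal{H},T,L,v)\text{ is a unilateral frame-tuple}\}.$$ Assume that $w\in\mathcal{V}$. Then, for $v\in\mathcal{H}$, one has $v\in\mathcal{V}$ if and only if $(\mathcal{H},T,L,v)$ is similar to $(\mathcal{H},T,L,w)$; i.e. $$\mathcal{V}=\{Bw: B\in\mathcal{B}(\mathcal{H}),\ B\text{ is invertible and commutes with }T\text{ and }L\}.$$
   Context: $\mathcal{B}(\mathcal{H})$ denotes the bounded linear operators on $\mathcal{H}$ and $\mathbb{N}_0=\{0,1,2,\dots\}$. For $v\in\mathcal{H}$, $(\mathcal{H},T,L,v)$ is a unilateral frame-tuple if $\{T^kL^jv: k\in\mathbb{Z}, j\in\mathbb{N}_0\}$ is a frame of $\mathcal{H}$. Two tuples $(\mathcal{H}_1,T_1,L_1,v_1)$ and $(\mathcal{H}_2,T_2,L_2,v_2)$ are similar if there is a bounded isomorphism (bounded linear bijection) $C:\mathcal{H}_1\to\mathcal{H}_2$ with $Cv_1=v_2$, $T_2C=CT_1$ and $L_2C=CL_1$. *)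

theory Defs
  imports "HOL-Analysis.Analysis"
begin

(* A complex Hilbert space carries the real inner product Re <x, y>, so positive
   definiteness, the norm sqrt <x, x> and the metric are those of real_inner.
   The inner product is linear in its first argument. *)
class complex_hilbert_space = real_inner + complete_space +
  fixes scaleC :: "complex \<Rightarrow> 'a \<Rightarrow> 'a"  (infixr \<open>*\<^sub>C\<close> 75)
    and cinner :: "'a \<Rightarrow> 'a \<Rightarrow> complex"
  assumes scaleC_add_right: "c *\<^sub>C (x + y) = c *\<^sub>C x + c *\<^sub>C y"
    and scaleC_add_left: "(c + d) *\<^sub>C x = c *\<^sub>C x + d *\<^sub>C x"
    and scaleC_scaleC: "c *\<^sub>C d *\<^sub>C x = (c * d) *\<^sub>C x"
    and scaleC_one: "1 *\<^sub>C x = x"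
    and scaleC_of_real: "complex_of_real r *\<^sub>C x = scaleR r x"
    and cinner_commute: "cinner x y = cnj (cinner y x)"
    and cinner_add_left: "cinner (x + y) z = cinner x z + cinner y z"
    and cinner_scaleC_left: "cinner (c *\<^sub>C x) y = c * cinner x y"
    and Re_cinner: "Re (cinner x y) = inner x y"

definition bounded_clinear :: "('a::complex_hilbert_space \<Rightarrow> 'b::complex_hilbert_space) \<Rightarrow> bool"
  where "bounded_clinear f \<longleftrightarrow> bounded_linear f \<and> (\<forall>c x. f (c *\<^sub>C x) = c *\<^sub>C f x)"

definition invertible_op :: "('a::complex_hilbert_space \<Rightarrow> 'a) \<Rightarrow> bool"
  where "invertible_op f \<longleftrightarrow>
    (\<exists>g. bounded_clinear g \<and> g \<circ> f = id \<and> f \<circ> g = id)"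

(* The power T^k for integer k; meaningful for bijective T. *)
definition op_powi :: "('a \<Rightarrow> 'a) \<Rightarrow> int \<Rightarrow> 'a \<Rightarrow> 'a"
  where "op_powi T k = (if 0 \<le> k then T ^^ nat k else inv T ^^ nat (- k))"

(* Frames are indexed families: repeated vectors count with multiplicity. *)
definition is_frame :: "('i \<Rightarrow> 'a::complex_hilbert_space) \<Rightarrow> bool"
  where "is_frame \<phi> \<longleftrightarrow>
    (\<exists>A B :: real. 0 < A \<and> 0 < B \<and>
      (\<forall>x. (\<lambda>i. (cmod (cinner x (\<phi> i)))\<^sup>2) summable_on UNIV \<and>
           A * (norm x)\<^sup>2 \<le> (\<Sum>\<^sub>\<infinity>i. (cmod (cinner x (\<phi> i)))\<^sup>2) \<and>
           (\<Sum>\<^sub>\<infinity>i. (cmod (cinner x (\<phi> i)))\<^sup>2) \<le> B * (norm x)\<^sup>2))"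

definition unilateral_frame_tuple ::
    "('a::complex_hilbert_space \<Rightarrow> 'a) \<Rightarrow> ('a \<Rightarrow> 'a) \<Rightarrow> 'a \<Rightarrow> bool"
  where "unilateral_frame_tuple T L v \<longleftrightarrow>
    is_frame (\<lambda>(k :: int, j :: nat). op_powi T k ((L ^^ j) v))"

definition similar_tuples ::
    "('a::complex_hilbert_space \<Rightarrow> 'a) \<Rightarrow> ('a \<Rightarrow> 'a) \<Rightarrow> 'a \<Rightarrow>
     ('b::complex_hilbert_space \<Rightarrow> 'b) \<Rightarrow> ('b \<Rightarrow> 'b) \<Rightarrow> 'b \<Rightarrow> bool"
  where "similar_tuples T1 L1 v1 T2 L2 v2 \<longleftrightarrow>
    (\<exists>C. bounded_clinear C \<and> bij C \<and> C v1 = v2 \<and> T2 \<circ> C = C \<circ> T1 \<and> L2 \<circ> C = C \<circ> L1)"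

definition frame_vectors :: "('a::complex_hilbert_space \<Rightarrow> 'a) \<Rightarrow> ('a \<Rightarrow> 'a) \<Rightarrow> 'a set"
  where "frame_vectors T L = {v. unilateral_frame_tuple T L v}"

end

theory Submission
  imports Defs
begin

text \<open>
  If \<open>v = B w\<close> with \<open>B\<close> invertible and commuting with \<open>T\<close> and \<open>L\<close>, then \<open>B\<close> maps the orbit of
  \<open>w\<close> to the orbit of \<open>v\<close>, and the image of a frame under an invertible operator is a frame
  (\<open>is_frame_image\<close>). A similarity is only assumed to be a bounded bijection; its inverse is bounded
  by the open mapping theorem (\<open>bounded_linear_inv\<close>).

  The substance is the converse. Let \<open>w\<close> and \<open>v\<close> both generate frames, and write
  \<open>\<phi> (k, j) = T\<^sup>k L\<^sup>j w\<close> and \<open>\<psi> (k, j) = T\<^sup>k L\<^sup>j v\<close>. A bounded operator mapping every \<open>\<phi> a\<close> to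
  \<open>\<psi> a\<close> exists as soon as every square-summable linear dependency of the \<open>\<phi> a\<close> is one of the \<open>\<psi> a\<close>
  (\<open>operator_of_kernel_inclusion\<close>). Such an operator commutes with \<open>T\<close> and \<open>L\<close>, and exchanging the
  roles of \<open>v\<close> and \<open>w\<close> gives its inverse. So the dependency statement has to be shown.

  Expand \<open>v\<close> as a series in the \<open>\<phi> a\<close>. If the series were finite, the statement would be clear by
  commutativity. In general one has to show that the densely defined map
  \<open>p(T, L) w \<mapsto> p(T, L) v\<close> is closable, and for this it is enough to have a total set of vectors
  \<open>x\<close> for which the sum over all \<open>(k, b)\<close> of the squared moduli of \<open>cinner (T\<^sup>k L\<^sup>b u) x\<close> is at most
  a multiple of \<open>(norm u)\<^sup>2\<close>. The canonical dual frame vectors \<open>x = S\<^sup>-\<^sup>1 (\<phi> m)\<close>, where \<open>S\<close> is the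
  frame operator of \<open>w\<close>, have this property. To see this, use the equivalent inner product given by
  \<open>S\<^sup>-\<^sup>1\<close>, for which the \<open>\<phi> a\<close> form a Parseval frame. There \<open>T\<close> is unitary, because it permutes the
  \<open>\<phi> a\<close> (\<open>dual_form_invariant\<close>), and \<open>L\<close> is a contraction. For the power \<open>X = L\<^sup>q\<close> and its adjoint
  \<open>X\<^sup>*\<close> with respect to this inner product, the squared norms satisfy
  \<open>\<parallel>X r\<parallel>\<^sup>2 - \<parallel>X\<^sup>* X r\<parallel>\<^sup>2 \<le> \<parallel>r\<parallel>\<^sup>2 - \<parallel>X r\<parallel>\<^sup>2\<close>. The left-hand side is the sum of the squared
  moduli of the coefficients of \<open>X r\<close> at the first \<open>q\<close> powers of \<open>L\<close> (\<open>energy_outside_shift_le\<close>). With \<open>r = L\<^sup>b u\<close> the right-hand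
  side telescopes in \<open>b\<close>, which gives the bound (\<open>orbit_functional_bound\<close>). On
  frame coefficients \<open>X\<^sup>*\<close> is a backward shift, which turns these inequalities into statements about
  square-summable families.
\<close>

text \<open>This makes the general results on unconditional sums in complete normed spaces apply.\<close>
instance complex_hilbert_space \<subseteq> banach ..

section \<open>Complex inner products\<close>

lemma cinner_add_right: "cinner x (y + z) = cinner x y + cinner x z"
  by (metis cinner_add_left cinner_commute complex_cnj_add)

lemma cinner_scaleC_right: "cinner x (c *\<^sub>C y) = cnj c * cinner x y"
  by (metis cinner_commute cinner_scaleC_left complex_cnj_mult)

lemma cinner_scaleR_left: "cinner (r *\<^sub>R x) y = r *\<^sub>R cinner x y"
  by (metis cinner_scaleC_left scaleC_of_real scaleR_conv_of_real)

lemma cinner_scaleR_right: "cinner x (r *\<^sub>R y) = r *\<^sub>R cinner x y"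
  by (metis cinner_scaleC_right scaleC_of_real scaleR_conv_of_real complex_cnj_complex_of_real)

lemma cinner_self: "cinner x x = complex_of_real ((norm x)\<^sup>2)"
proof (rule complex_eqI)
  show "Re (cinner x x) = Re (complex_of_real ((norm x)\<^sup>2))"
    by (simp add: Re_cinner power2_norm_eq_inner)
  have "Im (cinner x x) = - Im (cinner x x)"
    by (subst cinner_commute) simp
  then show "Im (cinner x x) = Im (complex_of_real ((norm x)\<^sup>2))" by simp
qed

lemma cmod_cinner_commute: "cmod (cinner x y) = cmod (cinner y x)"
  by (metis cinner_commute complex_mod_cnj)

lemma norm_scaleC: "norm (c *\<^sub>C x) = cmod c * norm x"
proof -
  have "complex_of_real ((norm (c *\<^sub>C x))\<^sup>2) = complex_of_real ((cmod c * norm x)\<^sup>2)"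
    unfolding cinner_self[symmetric] power_mult_distrib of_real_mult complex_norm_square
    by (simp add: cinner_scaleC_left cinner_scaleC_right)
  then have "(norm (c *\<^sub>C x))\<^sup>2 = (cmod c * norm x)\<^sup>2"
    using of_real_eq_iff by blast
  then show ?thesis by simp
qed

text \<open>Rotating \<open>x\<close> by the phase of \<open>cinner x y\<close> turns the modulus into a real inner product, so
  this follows from the real Cauchy--Schwarz inequality.\<close>
lemma cmod_cinner_le: "cmod (cinner x y) \<le> norm x * norm y"
proof -
  define c where "c = cnj (sgn (cinner x y))"
  have c: "c * cinner x y = complex_of_real (cmod (cinner x y))"
    unfolding c_def sgn_eq
    by (cases "cinner x y = 0")
      (simp_all add: complex_norm_square[symmetric] power2_eq_square mult.commute)
  have "cmod c \<le> 1" unfolding c_def by (simp add: norm_sgn)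
  have "cmod (cinner x y) = inner (c *\<^sub>C x) y"
    unfolding Re_cinner[symmetric] cinner_scaleC_left c by simp
  also have "\<dots> \<le> norm (c *\<^sub>C x) * norm y" by (rule norm_cauchy_schwarz)
  also have "\<dots> \<le> norm x * norm y"
    unfolding norm_scaleC using \<open>cmod c \<le> 1\<close>
    by (intro mult_right_mono) (auto intro: mult_left_le_one_le)
  finally show ?thesis .
qed

lemma bounded_linear_cinner_left: "bounded_linear (\<lambda>x. cinner x y)"
  by (rule bounded_linear_intro[where K = "norm y"])
    (auto simp: cinner_add_left cinner_scaleR_left cmod_cinner_le)

lemma bounded_linear_cinner_right: "bounded_linear (\<lambda>y. cinner x y)"
  by (rule bounded_linear_intro[where K = "norm x"])
    (auto simp: cinner_add_right cinner_scaleR_right cmod_cinner_le mult.commute[of _ "norm x"])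

lemma bounded_clinear_scaleC: "bounded_clinear (\<lambda>x. c *\<^sub>C x)"
  unfolding bounded_clinear_def
proof (intro conjI allI)
  show "bounded_linear (\<lambda>x. c *\<^sub>C x)"
    by (rule bounded_linear_intro[where K = "cmod c"])
      (auto simp: scaleC_add_right norm_scaleC mult.commute scaleC_scaleC
        simp flip: scaleC_of_real)
  show "c *\<^sub>C d *\<^sub>C x = d *\<^sub>C c *\<^sub>C x" for d and x :: 'a
    by (simp add: scaleC_scaleC mult.commute)
qed

lemma bounded_linear_scaleC_left: "bounded_linear (\<lambda>c. c *\<^sub>C x)"
  by (rule bounded_linear_intro[where K = "norm x"])
    (auto simp: scaleC_add_left norm_scaleC scaleC_scaleC scaleR_conv_of_real
      simp flip: scaleC_of_real)

lemmas cinner_sum_left = linear_sum[OF bounded_linear.linear[OF bounded_linear_cinner_left]]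
lemmas cinner_sum_right = linear_sum[OF bounded_linear.linear[OF bounded_linear_cinner_right]]
lemmas scaleC_diff_left = linear_diff[OF bounded_linear.linear[OF bounded_linear_scaleC_left]]
lemmas scaleC_zero_left = linear_0[OF bounded_linear.linear[OF bounded_linear_scaleC_left]]

lemma bounded_clinearD:
  assumes "bounded_clinear f"
  shows "bounded_linear f" "f (c *\<^sub>C x) = c *\<^sub>C f x"
  using assms by (auto simp: bounded_clinear_def)

lemma bounded_clinear_compose:
  "bounded_clinear f \<Longrightarrow> bounded_clinear g \<Longrightarrow> bounded_clinear (\<lambda>x. f (g x))"
  by (auto simp: bounded_clinear_def bounded_linear_compose)

lemma bounded_clinear_funpow:
  fixes f :: "'a::complex_hilbert_space \<Rightarrow> 'a"
  assumes "bounded_clinear f"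
  shows "bounded_clinear (f ^^ n)"
proof (induction n)
  case 0
  show ?case by (simp add: bounded_clinear_def bounded_linear_ident id_def)
next
  case (Suc n)
  then show ?case using bounded_clinear_compose[OF assms Suc] by (simp add: o_def)
qed

lemma bounded_clinear_sum:
  assumes "bounded_clinear f"
  shows "f (\<Sum>i\<in>F. c i *\<^sub>C x i) = (\<Sum>i\<in>F. c i *\<^sub>C f (x i))"
  using assms by (simp add: bounded_clinear_def linear_sum[OF bounded_linear.linear])

section \<open>Square-summable coefficients\<close>

abbreviation square_summable :: "('i \<Rightarrow> complex) \<Rightarrow> bool"
  where "square_summable c \<equiv> (\<lambda>i. (cmod (c i))\<^sup>2) summable_on UNIV"

abbreviation sq_norm :: "('i \<Rightarrow> complex) \<Rightarrow> real"
  where "sq_norm c \<equiv> (\<Sum>\<^sub>\<infinity>i. (cmod (c i))\<^sup>2)"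

lemma cmod_add_squared_le: "(cmod (a + b))\<^sup>2 \<le> 2 * (cmod a)\<^sup>2 + 2 * (cmod b)\<^sup>2"
proof -
  have "(cmod (a + b))\<^sup>2 \<le> (cmod a + cmod b)\<^sup>2"
    by (simp add: norm_triangle_ineq power_mono)
  also have "\<dots> \<le> 2 * (cmod a)\<^sup>2 + 2 * (cmod b)\<^sup>2"
    using sum_squares_bound[of "cmod a" "cmod b"] by (simp add: power2_sum)
  finally show ?thesis .
qed

lemma cmod_diff_squared: "(cmod (a - b))\<^sup>2 = (cmod a)\<^sup>2 - 2 * Re (a * cnj b) + (cmod b)\<^sup>2"
  unfolding cmod_power2 by (simp add: power2_eq_square algebra_simps)

lemma square_summable_comparison:
  assumes "f summable_on UNIV" "\<And>i. (cmod (c i))\<^sup>2 \<le> f i"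
  shows "square_summable c"
  by (rule summable_on_comparison_test[OF assms(1)]) (use assms(2) in auto)

lemma square_summable_diff:
  assumes "square_summable c" "square_summable d"
  shows "square_summable (\<lambda>i. c i - d i)"
proof (rule square_summable_comparison)
  show "(\<lambda>i. 2 * (cmod (c i))\<^sup>2 + 2 * (cmod (d i))\<^sup>2) summable_on UNIV"
    using assms by (intro summable_on_add summable_on_cmult_right)
  show "(cmod (c i - d i))\<^sup>2 \<le> 2 * (cmod (c i))\<^sup>2 + 2 * (cmod (d i))\<^sup>2" for i
    using cmod_add_squared_le[of "c i" "- d i"] by simp
qed

lemma sum_cmod_le_sq_norm:
  assumes "square_summable c" "finite F"
  shows "(\<Sum>i\<in>F. (cmod (c i))\<^sup>2) \<le> sq_norm c"
  using assms by (intro finite_sum_le_infsum) auto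

lemma finite_Cauchy_Schwarz:
  "(cmod (\<Sum>i\<in>F. c i * d i))\<^sup>2 \<le> (\<Sum>i\<in>F. (cmod (c i))\<^sup>2) * (\<Sum>i\<in>F. (cmod (d i))\<^sup>2)"
proof -
  have "cmod (\<Sum>i\<in>F. c i * d i) \<le> (\<Sum>i\<in>F. cmod (c i) * cmod (d i))"
    by (rule order_trans[OF norm_sum]) (simp add: norm_mult)
  then have "(cmod (\<Sum>i\<in>F. c i * d i))\<^sup>2 \<le> (\<Sum>i\<in>F. cmod (c i) * cmod (d i))\<^sup>2"
    by (simp add: power_mono)
  also have "\<dots> \<le> (\<Sum>i\<in>F. (cmod (c i))\<^sup>2) * (\<Sum>i\<in>F. (cmod (d i))\<^sup>2)"
    by (rule Cauchy_Schwarz_ineq_sum)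
  finally show ?thesis .
qed

lemma has_sum_norm_le:
  fixes f :: "'i \<Rightarrow> 'b::real_normed_vector"
  assumes "(f has_sum s) UNIV" "\<And>F. finite F \<Longrightarrow> norm (sum f F) \<le> C"
  shows "norm s \<le> C"
proof (rule Lim_norm_ubound)
  show "(sum f \<longlongrightarrow> s) (finite_subsets_at_top UNIV)"
    using assms(1) by (simp add: has_sum_def)
  show "eventually (\<lambda>F. norm (sum f F) \<le> C) (finite_subsets_at_top UNIV)"
    using assms(2) by (simp add: eventually_finite_subsets_at_top_weakI)
qed simp

text \<open>Finite partial sums of \<open>f\<close> are Cauchy as soon as they are controlled by those of a
  convergent series of nonnegative reals.\<close>
lemma summable_on_of_sq_bound:
  fixes f :: "'i \<Rightarrow> 'b::banach" and p :: "'i \<Rightarrow> real"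
  assumes p: "p summable_on UNIV"
    and bound: "\<And>F. finite F \<Longrightarrow> (norm (sum f F))\<^sup>2 \<le> sum p F"
  shows "f summable_on UNIV"
proof -
  have "p i \<ge> 0" for i
    using bound[of "{i}"] by (simp add: order_trans[OF zero_le_power2])
  define s where "s = infsum p UNIV"
  have lim: "(sum p \<longlongrightarrow> s) (finite_subsets_at_top UNIV)"
    using p has_sum_infsum[OF p] by (simp add: has_sum_def s_def)
  have "\<exists>P. eventually P (finite_subsets_at_top UNIV) \<and>
      (\<forall>F G. P F \<and> P G \<longrightarrow> dist (sum f F) (sum f G) < e)" if "e > 0" for e
  proof -
    define P where "P F \<longleftrightarrow> finite F \<and> dist (sum p F) s < (e/2)\<^sup>2" for F
    have "eventually P (finite_subsets_at_top UNIV)"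
      unfolding P_def using tendstoD[OF lim, of "(e/2)\<^sup>2"] that
      by (intro eventually_conj) (auto simp: eventually_finite_subsets_at_top_weakI)
    moreover have "dist (sum f F) (sum f G) < e" if "P F" "P G" for F G
    proof -
      have fin: "finite F" "finite G" using that by (auto simp: P_def)
      have one: "dist (sum f (F \<union> G)) (sum f K) < e/2"
        if K: "P K" "K \<subseteq> F \<union> G" for K
      proof -
        have "(norm (sum f (F \<union> G - K)))\<^sup>2 \<le> sum p (F \<union> G - K)"
          using fin by (intro bound) auto
        also have "\<dots> = sum p (F \<union> G) - sum p K"
          using fin K by (intro sum_diff) auto
        also have "\<dots> \<le> s - sum p K"
          using fin p \<open>\<And>i. p i \<ge> 0\<close> unfolding s_def
          by (intro diff_right_mono finite_sum_le_infsum) auto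
        also have "\<dots> < (e/2)\<^sup>2"
          using K by (auto simp: P_def dist_real_def)
        finally have "norm (sum f (F \<union> G - K)) < e/2"
          by (rule power_less_imp_less_base) (use \<open>e > 0\<close> in simp)
        moreover have "sum f (F \<union> G - K) = sum f (F \<union> G) - sum f K"
          using fin K by (intro sum_diff) auto
        ultimately show ?thesis by (simp add: dist_norm)
      qed
      have "dist (sum f F) (sum f G)
          \<le> dist (sum f (F \<union> G)) (sum f F) + dist (sum f (F \<union> G)) (sum f G)"
        by (rule dist_triangle3)
      also have "\<dots> < e/2 + e/2"
        using that by (intro add_strict_mono one) auto
      finally show ?thesis by simp
    qed
    ultimately show ?thesis by blast
  qed
  then have "cauchy_filter (filtermap (sum f) (finite_subsets_at_top UNIV))"
    by (simp add: cauchy_filter_metric_filtermap)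
  moreover have "complete (UNIV::'b set)"
    by (meson Cauchy_convergent UNIV_I complete_def convergent_def)
  ultimately obtain l where "(sum f \<longlongrightarrow> l) (finite_subsets_at_top UNIV)"
    using complete_uniform[where S = UNIV] by (force simp add: filterlim_def)
  then show ?thesis using summable_on_def has_sum_def by blast
qed

section \<open>Bounded inverses\<close>

text \<open>By the Baire category theorem, the image of some ball is dense in a ball; by linearity and
  scaling every \<open>z\<close> is then approximated arbitrarily well by images of vectors of norm at most a
  fixed multiple of \<open>norm z\<close>.\<close>
lemma surj_bounded_linear_approx:
  fixes f :: "'a::real_normed_vector \<Rightarrow> 'b::banach"
  assumes f: "bounded_linear f" and "surj f"
  obtains K where "0 < K" "\<And>z e. 0 < e \<Longrightarrow> \<exists>x. norm x \<le> K * norm z \<and> norm (z - f x) < e"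
proof -
  interpret bounded_linear f by fact
  define E where "E n = closure (f ` cball 0 (real n))" for n
  have "\<exists>n. interior (E n) \<noteq> {}"
  proof (rule ccontr)
    assume "\<not> ?thesis"
    then have "euclidean interior_of \<Union>(range E) = {}"
      using completely_metrizable_space_euclidean
      by (intro Baire_category_alt) (auto simp: E_def)
    moreover have "\<Union>(range E) = UNIV"
    proof -
      have "z \<in> \<Union>(range E)" for z
      proof -
        obtain x where "z = f x" using \<open>surj f\<close> by (metis surjD)
        moreover obtain n where "norm x \<le> real n" using real_arch_simple by blast
        ultimately have "z \<in> E n"
          unfolding E_def by (intro subsetD[OF closure_subset]) auto
        then show ?thesis by blast
      qed
      then show ?thesis by blast
    qed
    ultimately show False by simp
  qed
  then obtain n y where "y \<in> interior (E n)" by blast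
  then obtain r where r: "0 < r" "ball y r \<subseteq> E n"
    by (meson mem_interior)
  have near: "\<exists>x. norm x \<le> 2 * real n \<and> norm (z - f x) < e" if z: "norm z < r" and e: "0 < e" for z e
  proof -
    have "y \<in> E n" "y + z \<in> E n"
      using r z by (auto simp: subset_iff dist_norm)
    then obtain a b where a: "norm a \<le> real n" "dist (f a) (y + z) < e / 2"
      and b: "norm b \<le> real n" "dist (f b) y < e / 2"
      using e unfolding E_def closure_approachable by (force dest!: spec[of _ "e / 2"])
    have eq: "z - f (a - b) = (f b - y) - (f a - (y + z))" by (simp add: diff)
    have "norm (z - f (a - b)) < e"
      unfolding eq using a(2) b(2) norm_triangle_ineq4[of "f b - y" "f a - (y + z)"] unfolding dist_norm by linarith
    moreover have "norm (a - b) \<le> 2 * real n"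
      using a(1) b(1) norm_triangle_ineq4[of a b] by simp
    ultimately show ?thesis by blast
  qed
  define K where "K = 4 * real n / r + 1"
  have "0 < K" using r by (simp add: K_def add_nonneg_pos)
  moreover have "\<exists>x. norm x \<le> K * norm z \<and> norm (z - f x) < e" if "0 < e" for z e
  proof (cases "z = 0")
    case True
    then show ?thesis using that by (intro exI[of _ 0]) simp
  next
    case False
    define t where "t = r / (2 * norm z)"
    have t: "0 < t" using r False by (simp add: t_def)
    have "norm (t *\<^sub>R z) < r" using r False by (simp add: t_def)
    then obtain x where x: "norm x \<le> 2 * real n" "norm (t *\<^sub>R z - f x) < t * e"
      using near[of "t *\<^sub>R z" "t * e"] t \<open>0 < e\<close> by auto
    have "norm (x /\<^sub>R t) \<le> 2 * real n / t"
      using x(1) t by (simp add: field_simps)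
    also have "\<dots> \<le> K * norm z"
      using r False by (simp add: t_def K_def field_simps)
    finally have "norm (x /\<^sub>R t) \<le> K * norm z" .
    moreover have "z - f (x /\<^sub>R t) = (t *\<^sub>R z - f x) /\<^sub>R t"
      using t by (simp add: scaleR scaleR_diff_right)
    then have "norm (z - f (x /\<^sub>R t)) = norm (t *\<^sub>R z - f x) / t"
      using t by (simp add: divide_inverse mult.commute)
    then have "norm (z - f (x /\<^sub>R t)) < e"
      using x(2) t by (simp add: divide_less_eq mult.commute)
    ultimately show ?thesis by blast
  qed
  ultimately show thesis by (rule that)
qed

text \<open>Approximating \<open>z\<close> and then successively the remainders, with an error that is halved in every
  step, gives an exact preimage as a geometrically convergent series.\<close>
lemma bounded_linear_inv:
  fixes f :: "'a::banach \<Rightarrow> 'b::banach"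
  assumes f: "bounded_linear f" and bij: "bij f"
  shows "bounded_linear (inv f)"
proof -
  interpret bounded_linear f by fact
  obtain K where K: "0 < K" "\<And>z e. 0 < e \<Longrightarrow> \<exists>x. norm x \<le> K * norm z \<and> norm (z - f x) < e"
    using surj_bounded_linear_approx[OF f bij_is_surj[OF bij]] by blast
  have "\<exists>x. norm x \<le> K * norm z \<and> norm (z - f x) \<le> norm z / 2" for z
    using K(2)[of "norm z / 2" z] by (cases "z = 0") (auto intro: exI[of _ 0] less_imp_le)
  then obtain p where p: "\<And>z. norm (p z) \<le> K * norm z" "\<And>z. norm (z - f (p z)) \<le> norm z / 2"
    by metis
  have bound: "norm (inv f z) \<le> norm z * (2 * K)" for z
  proof -
    define r where "r n = ((\<lambda>z. z - f (p z)) ^^ n) z" for n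
    have r_Suc: "r (Suc n) = r n - f (p (r n))" for n by (simp add: r_def)
    have r: "norm (r n) \<le> norm z * (1 / 2) ^ n" for n
    proof (induction n)
      case 0
      then show ?case by (simp add: r_def)
    next
      case (Suc n)
      then show ?case using p(2)[of "r n"] by (simp add: r_Suc)
    qed
    have pr: "norm (p (r n)) \<le> K * norm z * (1 / 2) ^ n" for n
    proof -
      have "K * norm (r n) \<le> K * (norm z * (1 / 2) ^ n)"
        using K(1) by (intro mult_left_mono r) simp
      then show ?thesis using p(1)[of "r n"] by (simp only: mult.assoc)
    qed
    have geo: "(\<lambda>n. K * norm z * (1 / 2) ^ n) sums (K * norm z * 2)"
      using sums_mult[OF geometric_sums[of "1 / 2 :: real"], of "K * norm z"] by simp
    have summ: "summable (\<lambda>n. norm (p (r n)))"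
      using pr by (intro summable_comparison_test[OF _ sums_summable[OF geo]]) auto
    define x where "x = (\<Sum>n. p (r n))"
    have "norm x \<le> (\<Sum>n. norm (p (r n)))"
      unfolding x_def by (rule summable_norm[OF summ])
    also have "\<dots> \<le> K * norm z * 2"
      using suminf_le[OF pr summ sums_summable[OF geo]] sums_unique[OF geo] by simp
    finally have x: "norm x \<le> K * norm z * 2" .
    have "(\<lambda>n. f (p (r n))) sums f x"
      unfolding x_def by (intro sums summable_sums summable_norm_cancel[OF summ])
    moreover have "(\<lambda>n. f (p (r n))) sums z"
    proof -
      have "r \<longlonglongrightarrow> 0"
      proof (rule Lim_null_comparison)
        show "\<forall>\<^sub>F n in sequentially. norm (r n) \<le> norm z * (1 / 2) ^ n" using r by simp
        show "(\<lambda>n. norm z * (1 / 2) ^ n) \<longlonglongrightarrow> 0"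
          by (intro tendsto_mult_right_zero LIMSEQ_power_zero) simp
      qed
      then have "(\<lambda>n. r n - r (Suc n)) sums (r 0 - 0)" by (rule telescope_sums')
      then show ?thesis by (simp add: r_Suc) (simp add: r_def)
    qed
    ultimately have "f x = z" by (rule sums_unique2)
    then have "inv f z = x" using bij by (simp add: bij_inv_eq_iff eq_commute)
    with x show ?thesis by (simp add: mult_ac)
  qed
  have inv_eqI: "f x = z \<Longrightarrow> inv f z = x" for x z
    using bij by (simp add: bij_is_inj inv_f_eq)
  have [simp]: "f (inv f z) = z" for z
    using bij by (simp add: bij_is_surj surj_f_inv_f)
  show ?thesis
    by (rule bounded_linear_intro[OF _ _ bound]) (auto intro!: inv_eqI simp: add scaleR)
qed

lemma commute_inv:
  assumes "bij B" "B \<circ> f = f \<circ> B"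
  shows "inv B (f x) = f (inv B x)"
proof (rule inv_f_eq[OF bij_is_inj[OF assms(1)]])
  have "B (f (inv B x)) = f (B (inv B x))"
    using fun_cong[OF assms(2), of "inv B x"] by simp
  then show "B (f (inv B x)) = f x"
    using assms(1) by (simp add: bij_is_surj surj_f_inv_f)
qed

lemma bounded_clinear_inv:
  fixes f :: "'a::complex_hilbert_space \<Rightarrow> 'b::complex_hilbert_space"
  assumes "bounded_clinear f" "bij f"
  shows "bounded_clinear (inv f)"
proof -
  have "inv f (c *\<^sub>C x) = c *\<^sub>C inv f x" for c x
  proof (rule inv_f_eq[OF bij_is_inj[OF assms(2)]])
    show "f (c *\<^sub>C inv f x) = c *\<^sub>C x"
      using assms by (simp add: bounded_clinear_def bij_is_surj surj_f_inv_f)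
  qed
  then show ?thesis
    using bounded_linear_inv[OF bounded_clinearD(1)[OF assms(1)] assms(2)]
    by (simp add: bounded_clinear_def)
qed

section \<open>Bessel families and frames\<close>

definition synthesis :: "('i \<Rightarrow> 'a::complex_hilbert_space) \<Rightarrow> ('i \<Rightarrow> complex) \<Rightarrow> 'a"
  where "synthesis \<phi> c = (\<Sum>\<^sub>\<infinity>i. c i *\<^sub>C \<phi> i)"

locale bessel =
  fixes \<phi> :: "'i \<Rightarrow> 'a::complex_hilbert_space" and B :: real
  assumes B_pos: "0 < B"
    and analysis_summable: "square_summable (\<lambda>i. cinner x (\<phi> i))"
    and analysis_le: "sq_norm (\<lambda>i. cinner x (\<phi> i)) \<le> B * (norm x)\<^sup>2"
begin

text \<open>Boundedness of the finite synthesis maps is dual to boundedness of the analysis map: pair the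
  sum with itself.\<close>
lemma norm_finite_synthesis_le:
  assumes "finite F"
  shows "(norm (\<Sum>i\<in>F. c i *\<^sub>C \<phi> i))\<^sup>2 \<le> B * (\<Sum>i\<in>F. (cmod (c i))\<^sup>2)"
proof -
  define s where "s = (\<Sum>i\<in>F. c i *\<^sub>C \<phi> i)"
  have "complex_of_real ((norm s)\<^sup>2) = cinner s s"
    by (simp add: cinner_self)
  also have "\<dots> = (\<Sum>i\<in>F. c i * cinner (\<phi> i) s)"
    by (subst (1) s_def) (simp add: cinner_sum_left cinner_scaleC_left)
  finally have "((norm s)\<^sup>2)\<^sup>2 = (cmod (\<Sum>i\<in>F. c i * cinner (\<phi> i) s))\<^sup>2"
    by (metis norm_of_real power2_abs)
  also have "\<dots> \<le> (\<Sum>i\<in>F. (cmod (c i))\<^sup>2) * (\<Sum>i\<in>F. (cmod (cinner (\<phi> i) s))\<^sup>2)"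
    by (rule finite_Cauchy_Schwarz)
  also have "\<dots> \<le> (\<Sum>i\<in>F. (cmod (c i))\<^sup>2) * (B * (norm s)\<^sup>2)"
  proof (intro mult_left_mono sum_nonneg)
    have "(\<Sum>i\<in>F. (cmod (cinner (\<phi> i) s))\<^sup>2) = (\<Sum>i\<in>F. (cmod (cinner s (\<phi> i)))\<^sup>2)"
      by (simp add: cmod_cinner_commute[of s])
    also have "\<dots> \<le> B * (norm s)\<^sup>2"
      using sum_cmod_le_sq_norm[OF analysis_summable assms] analysis_le order_trans by blast
    finally show "(\<Sum>i\<in>F. (cmod (cinner (\<phi> i) s))\<^sup>2) \<le> B * (norm s)\<^sup>2" .
  qed simp
  finally have *: "(norm s)\<^sup>2 * (norm s)\<^sup>2 \<le> (B * (\<Sum>i\<in>F. (cmod (c i))\<^sup>2)) * (norm s)\<^sup>2"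
    by (simp add: power2_eq_square mult_ac)
  have "(norm s)\<^sup>2 \<le> B * (\<Sum>i\<in>F. (cmod (c i))\<^sup>2)"
  proof (cases "norm s = 0")
    case True
    then show ?thesis using B_pos by (simp add: sum_nonneg)
  next
    case False
    then have "0 < (norm s)\<^sup>2" by simp
    with * show ?thesis by (rule mult_right_le_imp_le)
  qed
  then show ?thesis by (simp add: s_def)
qed

lemma synthesis_has_sum:
  assumes "square_summable c"
  shows "((\<lambda>i. c i *\<^sub>C \<phi> i) has_sum synthesis \<phi> c) UNIV"
proof -
  have "(\<lambda>i. c i *\<^sub>C \<phi> i) summable_on UNIV"
  proof (rule summable_on_of_sq_bound)
    show "(\<lambda>i. B * (cmod (c i))\<^sup>2) summable_on UNIV"
      by (rule summable_on_cmult_right[OF assms])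
    show "(norm (\<Sum>i\<in>F. c i *\<^sub>C \<phi> i))\<^sup>2 \<le> (\<Sum>i\<in>F. B * (cmod (c i))\<^sup>2)" if "finite F" for F
      using norm_finite_synthesis_le[OF that] by (simp add: sum_distrib_left)
  qed
  then show ?thesis by (simp add: synthesis_def)
qed

lemma norm_synthesis_le:
  assumes "square_summable c"
  shows "(norm (synthesis \<phi> c))\<^sup>2 \<le> B * sq_norm c"
proof -
  have nn: "0 \<le> B * sq_norm c"
    using B_pos by (simp add: infsum_nonneg)
  have "norm (synthesis \<phi> c) \<le> sqrt (B * sq_norm c)"
  proof (rule has_sum_norm_le[OF synthesis_has_sum[OF assms]])
    fix F :: "'i set" assume F: "finite F"
    have "(norm (\<Sum>i\<in>F. c i *\<^sub>C \<phi> i))\<^sup>2 \<le> B * sq_norm c"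
      using norm_finite_synthesis_le[OF F, of c]
        mult_left_mono[OF sum_cmod_le_sq_norm[OF assms F], of B] B_pos by linarith
    then show "norm (\<Sum>i\<in>F. c i *\<^sub>C \<phi> i) \<le> sqrt (B * sq_norm c)"
      by (rule real_le_rsqrt)
  qed
  then show ?thesis
    using nn by (metis norm_ge_zero power_mono real_sqrt_pow2)
qed

lemma synthesis_map_has_sum:
  assumes "square_summable c" "bounded_clinear g"
  shows "((\<lambda>i. c i *\<^sub>C g (\<phi> i)) has_sum g (synthesis \<phi> c)) UNIV"
  using has_sum_bounded_linear[OF bounded_clinearD(1)[OF assms(2)] synthesis_has_sum[OF assms(1)]]
  by (simp add: bounded_clinearD(2)[OF assms(2)])

lemma synthesis_cinner_has_sum:
  assumes "square_summable c"
  shows "((\<lambda>i. c i * cinner (\<phi> i) y) has_sum cinner (synthesis \<phi> c) y) UNIV"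
  using has_sum_bounded_linear[OF bounded_linear_cinner_left synthesis_has_sum[OF assms]]
  by (simp add: cinner_scaleC_left)

lemma synthesis_diff:
  assumes "square_summable c" "square_summable d"
  shows "synthesis \<phi> (\<lambda>i. c i - d i) = synthesis \<phi> c - synthesis \<phi> d"
proof -
  have "((\<lambda>i. c i *\<^sub>C \<phi> i - d i *\<^sub>C \<phi> i) has_sum synthesis \<phi> c - synthesis \<phi> d) UNIV"
    using has_sum_add[OF synthesis_has_sum[OF assms(1)]
        has_sum_bounded_linear[OF bounded_linear_minus[OF bounded_linear_ident]
          synthesis_has_sum[OF assms(2)]]]
    by simp
  then show ?thesis
    unfolding synthesis_def by (intro infsumI) (simp add: scaleC_diff_left)
qed

lemma synthesis_add:
  assumes "square_summable c" "square_summable d"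
  shows "synthesis \<phi> (\<lambda>i. c i + d i) = synthesis \<phi> c + synthesis \<phi> d"
  using has_sum_add[OF assms[THEN synthesis_has_sum]]
  unfolding synthesis_def[of _ "\<lambda>i. c i + d i"] by (intro infsumI) (simp add: scaleC_add_left)

lemma synthesis_cmult:
  assumes "square_summable c"
  shows "synthesis \<phi> (\<lambda>i. a * c i) = a *\<^sub>C synthesis \<phi> c"
  using synthesis_map_has_sum[OF assms bounded_clinear_scaleC, of a]
  unfolding synthesis_def[of _ "\<lambda>i. a * c i"]
  by (intro infsumI) (simp add: scaleC_scaleC mult.commute)

end

lemma bessel_of_finite_synthesis_le:
  fixes \<phi> :: "'i \<Rightarrow> 'a::complex_hilbert_space"
  assumes "0 < B"
    and bound: "\<And>c F. finite F \<Longrightarrow>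
      (norm (\<Sum>i\<in>F. c i *\<^sub>C \<phi> i))\<^sup>2 \<le> B * (\<Sum>i\<in>F. (cmod (c i))\<^sup>2)"
  shows "bessel \<phi> B"
proof
  fix x :: 'a
  have *: "(\<Sum>i\<in>F. (cmod (cinner x (\<phi> i)))\<^sup>2) \<le> B * (norm x)\<^sup>2" if "finite F" for F
  proof -
    define c where "c i = cinner x (\<phi> i)" for i
    define s where "s = (\<Sum>i\<in>F. c i *\<^sub>C \<phi> i)"
    define q where "q = (\<Sum>i\<in>F. (cmod (c i))\<^sup>2)"
    have "cinner x s = (\<Sum>i\<in>F. cnj (c i) * c i)"
      by (simp add: s_def c_def cinner_sum_right cinner_scaleC_right)
    also have "\<dots> = complex_of_real q"
      by (simp only: q_def of_real_sum complex_norm_square mult.commute)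
    finally have "cinner x s = complex_of_real q" .
    then have "q \<le> norm x * norm s"
      using cmod_cinner_le[of x s] by simp
    moreover have "q \<ge> 0" by (simp add: q_def sum_nonneg)
    ultimately have "q\<^sup>2 \<le> (norm x)\<^sup>2 * (norm s)\<^sup>2"
      by (metis power_mono power_mult_distrib)
    also have "\<dots> \<le> (norm x)\<^sup>2 * (B * q)"
      unfolding s_def q_def by (intro mult_left_mono bound that) simp
    finally have "q * q \<le> (B * (norm x)\<^sup>2) * q"
      by (simp add: power2_eq_square mult_ac)
    then have "q \<le> B * (norm x)\<^sup>2"
      using \<open>q \<ge> 0\<close> assms(1) by (cases "q = 0") auto
    then show ?thesis by (simp add: q_def c_def)
  qed
  show s: "square_summable (\<lambda>i. cinner x (\<phi> i))"
    by (rule nonneg_bdd_above_summable_on) (auto intro!: bdd_aboveI2 *)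
  show "sq_norm (\<lambda>i. cinner x (\<phi> i)) \<le> B * (norm x)\<^sup>2"
    by (rule infsum_le_finite_sums[OF s]) (rule *)
qed (rule assms(1))

locale frame = bessel \<phi> B for \<phi> :: "'i \<Rightarrow> 'a::complex_hilbert_space" and B :: real +
  fixes A :: real
  assumes A_pos: "0 < A"
    and analysis_ge: "A * (norm x)\<^sup>2 \<le> sq_norm (\<lambda>i. cinner x (\<phi> i))"

lemma is_frame_iff: "is_frame \<phi> \<longleftrightarrow> (\<exists>B A. frame \<phi> B A)"
  unfolding is_frame_def frame_def bessel_def frame_axioms_def by blast

context frame
begin

definition frame_op :: "'a \<Rightarrow> 'a"
  where "frame_op x = synthesis \<phi> (\<lambda>i. cinner x (\<phi> i))"

lemma frame_op_cinner_has_sum: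
  "((\<lambda>i. cinner x (\<phi> i) * cinner (\<phi> i) y) has_sum cinner (frame_op x) y) UNIV"
  unfolding frame_op_def by (rule synthesis_cinner_has_sum[OF analysis_summable])

lemma cinner_frame_op: "cinner (frame_op x) y = cinner x (frame_op y)"
proof -
  have "((\<lambda>i. cnj (cinner x (\<phi> i) * cinner (\<phi> i) y)) has_sum cnj (cinner (frame_op x) y)) UNIV"
    using frame_op_cinner_has_sum by (simp only: has_sum_cnj_iff)
  moreover have "cnj (cinner x (\<phi> i) * cinner (\<phi> i) y) = cinner y (\<phi> i) * cinner (\<phi> i) x" for i
    using cinner_commute[of x] cinner_commute[of _ y] by (simp add: mult.commute)
  ultimately have "cnj (cinner (frame_op x) y) = cinner (frame_op y) x"
    using has_sum_unique[OF _ frame_op_cinner_has_sum[of y x]] by simp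
  then show ?thesis by (metis cinner_commute)
qed

lemma cinner_frame_op_self:
  "cinner (frame_op x) x = complex_of_real (sq_norm (\<lambda>i. cinner x (\<phi> i)))"
proof -
  have "((\<lambda>i. complex_of_real ((cmod (cinner x (\<phi> i)))\<^sup>2)) has_sum cinner (frame_op x) x) UNIV"
    using frame_op_cinner_has_sum[of x x] cinner_commute[of _ x]
    by (simp add: complex_norm_square flip: of_real_power)
  moreover have "((\<lambda>i. complex_of_real ((cmod (cinner x (\<phi> i)))\<^sup>2)) has_sum
      complex_of_real (sq_norm (\<lambda>i. cinner x (\<phi> i)))) UNIV"
    by (intro has_sum_of_real has_sum_infsum analysis_summable)
  ultimately show ?thesis by (rule has_sum_unique)
qed

lemma norm_frame_op_le: "norm (frame_op x) \<le> B * norm x"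
proof (rule power2_le_imp_le)
  have "(norm (frame_op x))\<^sup>2 \<le> B * sq_norm (\<lambda>i. cinner x (\<phi> i))"
    unfolding frame_op_def by (rule norm_synthesis_le[OF analysis_summable])
  also have "\<dots> \<le> B * (B * (norm x)\<^sup>2)"
    using analysis_le B_pos by (intro mult_left_mono) auto
  finally show "(norm (frame_op x))\<^sup>2 \<le> (B * norm x)\<^sup>2"
    by (simp add: power2_eq_square mult_ac)
qed (use B_pos in simp)

lemma norm_le_frame_op: "A * norm x \<le> norm (frame_op x)"
proof -
  have "A * (norm x)\<^sup>2 \<le> cmod (cinner (frame_op x) x)"
    using analysis_ge[of x] by (simp add: cinner_frame_op_self infsum_nonneg)
  also have "\<dots> \<le> norm (frame_op x) * norm x" by (rule cmod_cinner_le)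
  finally show ?thesis
    by (cases "norm x = 0") (auto simp: power2_eq_square)
qed

lemma bounded_clinear_frame_op: "bounded_clinear frame_op"
  unfolding bounded_clinear_def
proof (intro conjI allI)
  have C: "frame_op (c *\<^sub>C x) = c *\<^sub>C frame_op x" for c x
    unfolding frame_op_def cinner_scaleC_left by (rule synthesis_cmult[OF analysis_summable])
  then show "frame_op (c *\<^sub>C x) = c *\<^sub>C frame_op x" for c x .
  show "bounded_linear frame_op"
  proof (rule bounded_linear_intro)
    show "frame_op (x + y) = frame_op x + frame_op y" for x y
      unfolding frame_op_def cinner_add_left
      by (rule synthesis_add[OF analysis_summable analysis_summable])
    show "frame_op (r *\<^sub>R x) = r *\<^sub>R frame_op x" for r x
      by (metis C scaleC_of_real)
    show "norm (frame_op x) \<le> norm x * B" for x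
      using norm_frame_op_le[of x] by (simp add: mult.commute)
  qed
qed

lemmas frame_op_linear = bounded_linear.linear[OF bounded_clinearD(1)[OF bounded_clinear_frame_op]]

text \<open>For a small step \<open>t\<close> the map \<open>x \<mapsto> x - t (S x - y)\<close> is a contraction, because the frame operator
  \<open>S\<close> is bounded below as a quadratic form; its fixed point solves \<open>S x = y\<close>.\<close>
lemma bij_frame_op: "bij frame_op"
proof (rule bijI)
  show "inj frame_op"
  proof (rule injI)
    fix x y assume "frame_op x = frame_op y"
    then have "frame_op (x - y) = 0" by (simp add: linear_diff[OF frame_op_linear])
    then show "x = y" using norm_le_frame_op[of "x - y"] A_pos
      by (simp add: mult_le_0_iff)
  qed
  \<comment> \<open>This step size minimizes the contraction estimate \<open>1 - 2 * t * A + t\<^sup>2 * B\<^sup>2\<close>. The maximum in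
    \<open>q\<close> covers the zero space, where \<open>A\<close> may exceed \<open>B\<close>.\<close>
  define t where "t = A / B\<^sup>2"
  define q where "q = max 0 (1 - A\<^sup>2 / B\<^sup>2)"
  have q: "0 \<le> q" "q < 1" using A_pos B_pos by (auto simp: q_def)
  have contr: "(norm (x - t *\<^sub>R frame_op x))\<^sup>2 \<le> q * (norm x)\<^sup>2" for x
  proof -
    have t: "t > 0" using A_pos B_pos by (simp add: t_def)
    have "(norm (x - t *\<^sub>R frame_op x))\<^sup>2
        = (norm x)\<^sup>2 - 2 * t * inner (frame_op x) x + t\<^sup>2 * (norm (frame_op x))\<^sup>2"
      unfolding power2_norm_eq_inner
      by (simp add: inner_diff_left inner_diff_right inner_commute[of x "frame_op x"] power2_eq_square
          algebra_simps)
    also have "\<dots> \<le> (norm x)\<^sup>2 - 2 * t * (A * (norm x)\<^sup>2) + t\<^sup>2 * (B * norm x)\<^sup>2"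
    proof (intro add_mono diff_mono mult_left_mono power_mono norm_frame_op_le)
      show "A * (norm x)\<^sup>2 \<le> inner (frame_op x) x"
        using analysis_ge[of x] by (simp add: cinner_frame_op_self flip: Re_cinner)
    qed (use t in auto)
    also have "\<dots> = (1 - A\<^sup>2 / B\<^sup>2) * (norm x)\<^sup>2"
      using B_pos by (simp add: t_def power2_eq_square field_simps)
    also have "\<dots> \<le> q * (norm x)\<^sup>2"
      by (intro mult_right_mono) (auto simp: q_def)
    finally show ?thesis .
  qed
  show "surj frame_op"
    unfolding surj_def
  proof
    fix y
    define f where "f x = x - t *\<^sub>R (frame_op x - y)" for x
    have "\<forall>x x'. dist (f x) (f x') \<le> sqrt q * dist x x'"
    proof (intro allI)
      fix x x'
      have "f x - f x' = (x - x') - t *\<^sub>R frame_op (x - x')"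
        by (simp add: f_def linear_diff[OF frame_op_linear] algebra_simps)
      then have "(dist (f x) (f x'))\<^sup>2 \<le> q * (dist x x')\<^sup>2"
        using contr[of "x - x'"] by (simp add: dist_norm)
      then have "dist (f x) (f x') \<le> sqrt (q * (dist x x')\<^sup>2)" by (rule real_le_rsqrt)
      then show "dist (f x) (f x') \<le> sqrt q * dist x x'" by (simp add: real_sqrt_mult)
    qed
    then obtain x where "f x = x"
      using banach_fix_type[of "sqrt q" f] q by auto
    then have "frame_op x = y" using A_pos B_pos by (simp add: f_def t_def)
    then show "\<exists>x. y = frame_op x" by blast
  qed
qed

definition dual_op :: "'a \<Rightarrow> 'a"
  where "dual_op = inv frame_op"

lemma frame_op_dual_op [simp]: "frame_op (dual_op x) = x"
  unfolding dual_op_def by (simp add: bij_is_surj[OF bij_frame_op] surj_f_inv_f)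

lemma dual_op_frame_op [simp]: "dual_op (frame_op x) = x"
  unfolding dual_op_def by (simp add: bij_is_inj[OF bij_frame_op])

lemma dual_op_eqI: "frame_op y = x \<Longrightarrow> dual_op x = y"
  by auto

lemma bounded_clinear_dual_op: "bounded_clinear dual_op"
  unfolding bounded_clinear_def
proof (intro conjI allI)
  have C: "dual_op (c *\<^sub>C x) = c *\<^sub>C dual_op x" for c x
    by (rule dual_op_eqI) (simp add: bounded_clinearD[OF bounded_clinear_frame_op])
  then show "dual_op (c *\<^sub>C x) = c *\<^sub>C dual_op x" for c x .
  show "bounded_linear dual_op"
  proof (rule bounded_linear_intro)
    show "dual_op (x + y) = dual_op x + dual_op y" for x y
      by (rule dual_op_eqI) (simp add: linear_add[OF frame_op_linear])
    show "dual_op (r *\<^sub>R x) = r *\<^sub>R dual_op x" for r x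
      by (metis C scaleC_of_real)
    show "norm (dual_op x) \<le> norm x * (1 / A)" for x
      using norm_le_frame_op[of "dual_op x"] A_pos by (simp add: field_simps)
  qed
qed

lemma cinner_dual_op: "cinner (dual_op x) y = cinner x (dual_op y)"
  using cinner_frame_op[of "dual_op x" "dual_op y"] by simp

definition dual_coeff :: "'a \<Rightarrow> 'i \<Rightarrow> complex"
  where "dual_coeff x i = cinner (dual_op x) (\<phi> i)"

text \<open>The squared norm of the equivalent inner product in which \<open>\<phi>\<close> becomes a Parseval frame.\<close>
definition energy :: "'a \<Rightarrow> real"
  where "energy x = sq_norm (dual_coeff x)"

lemma dual_coeff_summable: "square_summable (dual_coeff x)"
  unfolding dual_coeff_def by (rule analysis_summable)

lemma cnj_dual_coeff: "cnj (dual_coeff x i) = cinner (\<phi> i) (dual_op x)"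
  unfolding dual_coeff_def by (metis cinner_commute)

lemma synthesis_dual_coeff [simp]: "synthesis \<phi> (dual_coeff x) = x"
  using frame_op_dual_op[of x] unfolding frame_op_def dual_coeff_def .

lemma energy_nonneg: "0 \<le> energy x"
  unfolding energy_def by (rule infsum_nonneg) simp

lemma cinner_dual_op_self: "cinner x (dual_op x) = complex_of_real (energy x)"
  using cinner_frame_op_self[of "dual_op x"] by (simp add: energy_def dual_coeff_def)

lemma energy_le: "energy x \<le> B / A\<^sup>2 * (norm x)\<^sup>2"
proof -
  have "energy x \<le> B * (norm (dual_op x))\<^sup>2"
    unfolding energy_def dual_coeff_def by (rule analysis_le)
  also have "\<dots> \<le> B * (norm x / A)\<^sup>2"
    using norm_le_frame_op[of "dual_op x"] A_pos B_pos
    by (intro mult_left_mono power_mono) (auto simp: field_simps)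
  finally show ?thesis by (simp add: power_divide)
qed

lemma eq_0_of_orthogonal_frame:
  assumes "\<And>i. cinner x (\<phi> i) = 0"
  shows "x = 0"
  using analysis_ge[of x] assms A_pos by (simp add: mult_le_0_iff)

text \<open>An operator that permutes the frame vectors is unitary for the inner product
  \<open>cinner (dual_op x) y\<close>: it permutes the terms of the frame operator.\<close>
lemma dual_form_invariant:
  assumes g: "bounded_clinear g" "inj g" and p: "bij p" and gp: "\<And>i. g (\<phi> i) = \<phi> (p i)"
  shows "cinner (dual_op (g x)) (g y) = cinner (dual_op x) y"
proof -
  define z where "z i = dual_coeff (g x) (p i)" for i
  have z: "square_summable z"
    unfolding z_def using dual_coeff_summable[of "g x"]
    by (simp add: summable_on_reindex_bij_betw[OF p, of "\<lambda>i. (cmod (dual_coeff (g x) i))\<^sup>2"])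
  have "((\<lambda>i. dual_coeff (g x) i *\<^sub>C \<phi> i) has_sum g x) UNIV"
    using synthesis_has_sum[OF dual_coeff_summable[of "g x"]] by simp
  then have "((\<lambda>i. z i *\<^sub>C g (\<phi> i)) has_sum g x) UNIV"
    by (simp add: z_def gp has_sum_reindex_bij_betw[OF p, of "\<lambda>i. dual_coeff (g x) i *\<^sub>C \<phi> i"])
  then have "g (synthesis \<phi> z) = g x"
    using synthesis_map_has_sum[OF z g(1)] has_sum_unique by blast
  then have zx: "synthesis \<phi> z = x" using g(2) by (simp add: inj_eq)
  have "((\<lambda>i. dual_coeff y i *\<^sub>C g (\<phi> i)) has_sum g y) UNIV"
    using synthesis_map_has_sum[OF dual_coeff_summable[of y] g(1)] by simp
  then have "((\<lambda>i. cinner (dual_op (g x)) (dual_coeff y i *\<^sub>C g (\<phi> i)))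
      has_sum cinner (dual_op (g x)) (g y)) UNIV"
    by (rule has_sum_bounded_linear[OF bounded_linear_cinner_right])
  then have "((\<lambda>i. z i * cinner (\<phi> i) (dual_op y)) has_sum cinner (dual_op (g x)) (g y)) UNIV"
    by (simp add: cinner_scaleC_right gp cnj_dual_coeff z_def dual_coeff_def[of "g x"] mult.commute)
  moreover have "((\<lambda>i. z i * cinner (\<phi> i) (dual_op y)) has_sum cinner x (dual_op y)) UNIV"
    using synthesis_cinner_has_sum[OF z, of "dual_op y"] by (simp add: zx)
  ultimately show ?thesis
    by (metis has_sum_unique cinner_dual_op)
qed

text \<open>Let \<open>X\<close> act on the frame vectors by an injection \<open>s\<close> of the index set. In the Parseval inner
  product, the adjoint of \<open>X\<close> shifts coefficients back along \<open>s\<close>, and the left-hand side is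
  the squared norm of \<open>X r\<close> minus that of \<open>X\<^sup>* X r\<close>. So the inequality expresses that
  \<open>r - X\<^sup>* X r\<close> has nonnegative squared norm; on coefficients this is the sum of the terms
  \<open>cmod (dual_coeff r i - dual_coeff (X r) (s i))\<^sup>2\<close>.\<close>
lemma energy_outside_shift_le:
  assumes X: "bounded_clinear X" and s: "inj s" and Xs: "\<And>i. X (\<phi> i) = \<phi> (s i)"
  shows "(\<Sum>\<^sub>\<infinity>i\<in>- range s. (cmod (dual_coeff (X r) i))\<^sup>2) \<le> energy r - energy (X r)"
proof -
  define a where "a = dual_coeff r"
  define b where "b = dual_coeff (X r)"
  have sa: "square_summable a" and sb: "square_summable b"
    unfolding a_def b_def by (rule dual_coeff_summable)+
  have sbr: "(\<lambda>i. (cmod (b i))\<^sup>2) summable_on S" for S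
    using sb by (rule summable_on_subset_banach) simp
  have sbs: "square_summable (\<lambda>i. b (s i))"
    using summable_on_reindex[OF s, of "\<lambda>i. (cmod (b i))\<^sup>2"] sbr by (simp add: o_def)
  have split: "energy (X r) = sq_norm (\<lambda>i. b (s i)) + (\<Sum>\<^sub>\<infinity>i\<in>- range s. (cmod (b i))\<^sup>2)"
  proof -
    have "energy (X r) = (\<Sum>\<^sub>\<infinity>i\<in>range s \<union> - range s. (cmod (b i))\<^sup>2)"
      by (simp add: energy_def b_def)
    also have "\<dots> = (\<Sum>\<^sub>\<infinity>i\<in>range s. (cmod (b i))\<^sup>2) + (\<Sum>\<^sub>\<infinity>i\<in>- range s. (cmod (b i))\<^sup>2)"
      by (intro infsum_Un_disjoint sbr) auto
    also have "(\<Sum>\<^sub>\<infinity>i\<in>range s. (cmod (b i))\<^sup>2) = sq_norm (\<lambda>i. b (s i))"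
      using infsum_reindex[OF s, of "\<lambda>i. (cmod (b i))\<^sup>2"] by (simp add: o_def)
    finally show ?thesis .
  qed
  have "((\<lambda>i. a i *\<^sub>C X (\<phi> i)) has_sum X r) UNIV"
    using synthesis_map_has_sum[OF sa X] by (simp add: a_def)
  then have "((\<lambda>i. cinner (a i *\<^sub>C X (\<phi> i)) (dual_op (X r))) has_sum
      cinner (X r) (dual_op (X r))) UNIV"
    by (rule has_sum_bounded_linear[OF bounded_linear_cinner_left])
  then have "((\<lambda>i. a i * cnj (b (s i))) has_sum complex_of_real (energy (X r))) UNIV"
    by (simp add: cinner_scaleC_left Xs b_def cnj_dual_coeff cinner_dual_op_self)
  from has_sum_Re[OF this]
  have cross: "((\<lambda>i. Re (a i * cnj (b (s i)))) has_sum energy (X r)) UNIV" by simp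
  have "((\<lambda>i. (cmod (a i - b (s i)))\<^sup>2) has_sum
      energy r + (- 2) * energy (X r) + sq_norm (\<lambda>i. b (s i))) UNIV"
  proof -
    have "((\<lambda>i. (cmod (a i))\<^sup>2 + (- 2) * Re (a i * cnj (b (s i))) + (cmod (b (s i)))\<^sup>2) has_sum
        energy r + (- 2) * energy (X r) + sq_norm (\<lambda>i. b (s i))) UNIV"
      using has_sum_infsum[OF sa] has_sum_infsum[OF sbs]
      by (intro has_sum_add has_sum_cmult_right[OF cross]) (auto simp: energy_def a_def)
    then show ?thesis
      unfolding cmod_diff_squared mult_minus_left add_uminus_conv_diff .
  qed
  then have "0 \<le> energy r + (- 2) * energy (X r) + sq_norm (\<lambda>i. b (s i))"
    by (rule has_sum_nonneg) simp
  then show ?thesis using split by (simp add: b_def)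
qed

end

section \<open>Operators acting on frame vectors\<close>

lemma (in frame) eq_on_frame_vectors:
  assumes "bounded_clinear f" "bounded_clinear g" "\<And>i. f (\<phi> i) = g (\<phi> i)"
  shows "f = g"
proof
  fix x
  have "((\<lambda>i. dual_coeff x i *\<^sub>C f (\<phi> i)) has_sum f x) UNIV"
    using synthesis_map_has_sum[OF dual_coeff_summable[of x] assms(1)] by simp
  moreover have "((\<lambda>i. dual_coeff x i *\<^sub>C f (\<phi> i)) has_sum g x) UNIV"
    using synthesis_map_has_sum[OF dual_coeff_summable[of x] assms(2)] by (simp add: assms(3))
  ultimately show "f x = g x" by (rule has_sum_unique)
qed

lemma synthesis_indicator: "synthesis \<phi> (\<lambda>i. if i = l then 1 else 0) = \<phi> l"
  unfolding synthesis_def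
  by (intro infsumI has_sum_finite_neutralI[where B = "{l}"])
    (auto simp: scaleC_one scaleC_zero_left)

lemma square_summable_indicator: "square_summable (\<lambda>i. if i = l then 1 else 0)"
  by (rule finite_nonzero_values_imp_summable_on) (rule finite_subset[of _ "{l}"], auto)

text \<open>The operator synthesizes \<open>\<psi>\<close> from the canonical dual coefficients, so it is bounded by the bounds of
  the two families. The inclusion of dependencies makes it map \<open>\<phi> l\<close> to
  \<open>\<psi> l\<close>, although the dual coefficients of \<open>\<phi> l\<close> need not be the unit sequence at \<open>l\<close>.\<close>
lemma (in frame) operator_of_kernel_inclusion:
  fixes \<psi> :: "'i \<Rightarrow> 'b::complex_hilbert_space"
  assumes "bessel \<psi> D"
    and kernel: "\<And>c. square_summable c \<Longrightarrow> synthesis \<phi> c = 0 \<Longrightarrow> synthesis \<psi> c = 0"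
  shows "\<exists>C. bounded_clinear C \<and> (\<forall>i. C (\<phi> i) = \<psi> i)"
proof -
  interpret \<psi>: bessel \<psi> D by fact
  define C where "C x = synthesis \<psi> (dual_coeff x)" for x
  have C_scaleC: "C (c *\<^sub>C x) = c *\<^sub>C C x" for c x
  proof -
    have "dual_coeff (c *\<^sub>C x) = (\<lambda>i. c * dual_coeff x i)"
      by (rule ext) (simp add: dual_coeff_def bounded_clinearD(2)[OF bounded_clinear_dual_op]
          cinner_scaleC_left)
    then show ?thesis
      unfolding C_def by (simp add: \<psi>.synthesis_cmult[OF dual_coeff_summable])
  qed
  have C_add: "C (x + y) = C x + C y" for x y
  proof -
    have "dual_coeff (x + y) = (\<lambda>i. dual_coeff x i + dual_coeff y i)"
      by (rule ext) (simp add: dual_coeff_def cinner_add_left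
          linear_add[OF bounded_linear.linear[OF bounded_clinearD(1)[OF bounded_clinear_dual_op]]])
    then show ?thesis
      unfolding C_def by (simp add: \<psi>.synthesis_add[OF dual_coeff_summable dual_coeff_summable])
  qed
  have C_norm: "norm (C x) \<le> norm x * sqrt (D * (B / A\<^sup>2))" for x
  proof (rule power2_le_imp_le)
    have "(norm (C x))\<^sup>2 \<le> D * energy x"
      unfolding C_def energy_def by (rule \<psi>.norm_synthesis_le[OF dual_coeff_summable])
    also have "\<dots> \<le> D * (B / A\<^sup>2 * (norm x)\<^sup>2)"
      using \<psi>.B_pos by (intro mult_left_mono energy_le) auto
    also have "\<dots> = (norm x * sqrt (D * (B / A\<^sup>2)))\<^sup>2"
      using \<psi>.B_pos B_pos by (simp add: power_mult_distrib)
    finally show "(norm (C x))\<^sup>2 \<le> (norm x * sqrt (D * (B / A\<^sup>2)))\<^sup>2" .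
  qed (use \<psi>.B_pos B_pos in simp)
  have "bounded_clinear C"
    unfolding bounded_clinear_def
    by (intro conjI allI bounded_linear_intro[OF C_add _ C_norm] C_scaleC)
      (metis C_scaleC scaleC_of_real)
  moreover have "C (\<phi> l) = \<psi> l" for l
  proof -
    define e :: "'i \<Rightarrow> complex" where "e = (\<lambda>i. if i = l then 1 else 0)"
    have e: "square_summable e" unfolding e_def by (rule square_summable_indicator)
    \<comment> \<open>Two expansions of \<open>\<phi> l\<close> differ by a dependency.\<close>
    have "synthesis \<phi> (\<lambda>i. dual_coeff (\<phi> l) i - e i) = 0"
      by (simp add: synthesis_diff[OF dual_coeff_summable e])
        (simp add: e_def synthesis_indicator)
    then have "synthesis \<psi> (\<lambda>i. dual_coeff (\<phi> l) i - e i) = 0"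
      by (intro kernel square_summable_diff dual_coeff_summable e)
    then show ?thesis
      unfolding \<psi>.synthesis_diff[OF dual_coeff_summable e] C_def
      by (simp add: e_def synthesis_indicator)
  qed
  ultimately show ?thesis by blast
qed

text \<open>Upper frame bounds amount to bounded synthesis, which \<open>g\<close> preserves. For the lower bound, apply
  \<open>g\<close> to an expansion of \<open>h x\<close> with controlled coefficients and pair the resulting expansion of
  \<open>x\<close> with \<open>x\<close>.\<close>
lemma (in frame) is_frame_image:
  fixes g :: "'a \<Rightarrow> 'b::complex_hilbert_space"
  assumes g: "bounded_clinear g" and h: "bounded_clinear h" and gh: "\<And>x. g (h x) = x"
  shows "is_frame (\<lambda>i. g (\<phi> i))"
proof -
  obtain M where M: "0 < M" "\<And>x. norm (g x) \<le> norm x * M"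
    using bounded_linear.pos_bounded[OF bounded_clinearD(1)[OF g]] by blast
  obtain N where N: "0 < N" "\<And>x. norm (h x) \<le> norm x * N"
    using bounded_linear.pos_bounded[OF bounded_clinearD(1)[OF h]] by blast
  interpret g: bessel "\<lambda>i. g (\<phi> i)" "M\<^sup>2 * B"
  proof (rule bessel_of_finite_synthesis_le)
    show "0 < M\<^sup>2 * B" using M(1) B_pos by simp
    fix c :: "'i \<Rightarrow> complex" and F :: "'i set" assume F: "finite F"
    have "(norm (\<Sum>i\<in>F. c i *\<^sub>C g (\<phi> i)))\<^sup>2 = (norm (g (\<Sum>i\<in>F. c i *\<^sub>C \<phi> i)))\<^sup>2"
      by (simp add: bounded_clinear_sum[OF g])
    also have "\<dots> \<le> (norm (\<Sum>i\<in>F. c i *\<^sub>C \<phi> i) * M)\<^sup>2"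
      by (intro power_mono M(2)) simp
    also have "\<dots> = M\<^sup>2 * (norm (\<Sum>i\<in>F. c i *\<^sub>C \<phi> i))\<^sup>2"
      by (simp add: power_mult_distrib)
    also have "\<dots> \<le> M\<^sup>2 * (B * (\<Sum>i\<in>F. (cmod (c i))\<^sup>2))"
      by (intro mult_left_mono norm_finite_synthesis_le F) simp
    finally show "(norm (\<Sum>i\<in>F. c i *\<^sub>C g (\<phi> i)))\<^sup>2 \<le> M\<^sup>2 * B * (\<Sum>i\<in>F. (cmod (c i))\<^sup>2)"
      by (simp add: mult.assoc)
  qed
  define K where "K = B / A\<^sup>2 * N\<^sup>2"
  have K: "0 < K" using B_pos A_pos N(1) by (simp add: K_def)
  have "1 / K * (norm x)\<^sup>2 \<le> sq_norm (\<lambda>i. cinner x (g (\<phi> i)))" for x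
  proof -
    define d where "d = dual_coeff (h x)"
    define Q where "Q = sq_norm (\<lambda>i. cinner x (g (\<phi> i)))"
    have d: "square_summable d" unfolding d_def by (rule dual_coeff_summable)
    have Q: "0 \<le> Q" unfolding Q_def by (rule infsum_nonneg) simp
    have "sq_norm d \<le> B / A\<^sup>2 * (norm (h x))\<^sup>2"
      using energy_le[of "h x"] by (simp add: energy_def d_def)
    also have "\<dots> \<le> B / A\<^sup>2 * (norm x * N)\<^sup>2"
      using B_pos by (intro mult_left_mono power_mono N(2)) auto
    finally have dK: "sq_norm d \<le> K * (norm x)\<^sup>2"
      by (simp add: K_def power_mult_distrib mult_ac)
    have "((\<lambda>i. d i *\<^sub>C g (\<phi> i)) has_sum x) UNIV"
      using synthesis_map_has_sum[OF d g] by (simp add: d_def gh)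
    from has_sum_bounded_linear[OF bounded_linear_cinner_left[of x] this]
    have "((\<lambda>i. d i * cinner (g (\<phi> i)) x) has_sum complex_of_real ((norm x)\<^sup>2)) UNIV"
      by (simp add: cinner_scaleC_left cinner_self)
    then have "norm (complex_of_real ((norm x)\<^sup>2)) \<le> sqrt (K * (norm x)\<^sup>2 * Q)"
    proof (rule has_sum_norm_le)
      fix F :: "'i set" assume F: "finite F"
      have "(cmod (\<Sum>i\<in>F. d i * cinner (g (\<phi> i)) x))\<^sup>2
          \<le> (\<Sum>i\<in>F. (cmod (d i))\<^sup>2) * (\<Sum>i\<in>F. (cmod (cinner x (g (\<phi> i))))\<^sup>2)"
        using finite_Cauchy_Schwarz[of d "\<lambda>i. cinner (g (\<phi> i)) x" F]
        by (simp add: cmod_cinner_commute[of x])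
      also have "\<dots> \<le> K * (norm x)\<^sup>2 * Q"
        using sum_cmod_le_sq_norm[OF d F] dK K sum_cmod_le_sq_norm[OF g.analysis_summable[of x] F]
        by (intro mult_mono) (auto simp: Q_def intro: sum_nonneg)
      finally show "cmod (\<Sum>i\<in>F. d i * cinner (g (\<phi> i)) x) \<le> sqrt (K * (norm x)\<^sup>2 * Q)"
        by (rule real_le_rsqrt)
    qed
    then have "(norm x)\<^sup>2 \<le> sqrt (K * (norm x)\<^sup>2 * Q)"
      unfolding norm_of_real by simp
    then have "((norm x)\<^sup>2)\<^sup>2 \<le> (sqrt (K * (norm x)\<^sup>2 * Q))\<^sup>2"
      by (intro power_mono) simp_all
    also have "\<dots> = K * (norm x)\<^sup>2 * Q" using K Q by simp
    finally have "((norm x)\<^sup>2)\<^sup>2 \<le> K * (norm x)\<^sup>2 * Q" .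
    then have *: "(norm x)\<^sup>2 * (norm x)\<^sup>2 \<le> (K * Q) * (norm x)\<^sup>2"
      by (simp add: power2_eq_square mult_ac)
    have "(norm x)\<^sup>2 \<le> K * Q"
    proof (cases "x = 0")
      case True
      then show ?thesis using K Q by simp
    next
      case False
      then have "0 < (norm x)\<^sup>2" by simp
      with * show ?thesis by (rule mult_right_le_imp_le)
    qed
    then show ?thesis using K by (simp add: Q_def field_simps)
  qed
  then have "frame (\<lambda>i. g (\<phi> i)) (M\<^sup>2 * B) (1 / K)"
    using K by unfold_locales simp_all
  then show ?thesis unfolding is_frame_iff by blast
qed

section \<open>Unilateral orbits\<close>

lemma op_powi_Suc:
  assumes "bij T"
  shows "op_powi T (k + 1) x = T (op_powi T k x)"
proof (cases "0 \<le> k")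
  case True
  then show ?thesis by (simp add: op_powi_def nat_add_distrib)
next
  case False
  then obtain n where k: "k = - int (Suc n)"
    by (metis not_le negD)
  show ?thesis
    using assms by (cases n) (simp_all add: k op_powi_def nat_add_distrib bij_is_surj surj_f_inv_f)
qed

lemma op_powi_0 [simp]: "op_powi T 0 x = x"
  by (simp add: op_powi_def)

lemma op_powi_pred:
  assumes "bij T"
  shows "op_powi T (k - 1) x = inv T (op_powi T k x)"
  using op_powi_Suc[OF assms, of "k - 1" x] assms by (simp add: bij_is_inj)

lemma op_powi_add:
  assumes "bij T"
  shows "op_powi T (k + l) x = op_powi T k (op_powi T l x)"
proof (induction k rule: int_induct[where k = 0])
  case (step1 k)
  then show ?case
    using op_powi_Suc[OF assms, of "k + l" x] op_powi_Suc[OF assms, of k] by (simp add: add_ac)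
next
  case (step2 k)
  then show ?case
    using op_powi_pred[OF assms, of "k + l" x] op_powi_pred[OF assms, of k]
    by (simp add: algebra_simps)
qed simp

lemma op_powi_commute:
  assumes "bij T" "\<And>x. f (T x) = T (f x)"
  shows "f (op_powi T k x) = op_powi T k (f x)"
proof (induction k rule: int_induct[where k = 0])
  case (step1 k)
  then show ?case by (simp add: op_powi_Suc[OF assms(1)] assms(2))
next
  case (step2 k)
  have "f (inv T y) = inv T (f y)" for y
    by (metis assms bij_inv_eq_iff)
  with step2 show ?case by (simp add: op_powi_pred[OF assms(1)])
qed simp

lemma funpow_commute:
  assumes "\<And>x. f (g x) = g (f x)"
  shows "f ((g ^^ n) x) = (g ^^ n) (f x)"
  by (induction n) (simp_all add: assms)

lemma invertible_opD:
  assumes "invertible_op T"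
  shows "bij T" "bounded_clinear (inv T)"
proof -
  obtain g where g: "bounded_clinear g" "g \<circ> T = id" "T \<circ> g = id"
    using assms by (auto simp: invertible_op_def)
  show "bij T" using o_bij[OF g(2,3)] .
  have "inv T = g" using g(2,3) by (intro inv_unique_comp)
  then show "bounded_clinear (inv T)" using g(1) by simp
qed

text \<open>The terms \<open>f b - f (b + q)\<close> telescope with step \<open>q\<close>; the first \<open>q\<close> terms of \<open>g\<close> are bounded
  separately, which accounts for the factor 2.\<close>
lemma sum_le_of_telescoping_bound:
  fixes f g :: "nat \<Rightarrow> real"
  assumes "\<And>b. g b \<le> f b" "\<And>b. g (b + q) \<le> f b - f (b + q)" "\<And>b. 0 \<le> f b"
  shows "(\<Sum>b<N + q. g b) \<le> 2 * (\<Sum>b<q. f b)"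
proof -
  have "(\<Sum>b<N + q. g b) + (\<Sum>b=N..<N + q. f b) \<le> 2 * (\<Sum>b<q. f b)"
  proof (induction N)
    case 0
    then show ?case using sum_mono[of "{..<q}" g f] assms(1)
      by (simp add: atLeast0LessThan)
  next
    case (Suc N)
    have "(\<Sum>b=N..<N + q. f b) + f (N + q) = f N + (\<Sum>b=Suc N..<Suc N + q. f b)"
      using sum.atLeast_Suc_lessThan[of N "Suc (N + q)" f]
        sum.atLeastLessThan_Suc[of N "N + q" f] by simp
    then show ?case using Suc assms(2)[of N] by simp
  qed
  moreover have "0 \<le> (\<Sum>b=N..<N + q. f b)" by (intro sum_nonneg assms(3))
  ultimately show ?thesis by linarith
qed

locale commuting_pair =
  fixes T L :: "'a::complex_hilbert_space \<Rightarrow> 'a"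
  assumes clinear_T: "bounded_clinear T" and clinear_L: "bounded_clinear L"
    and invertible_T: "invertible_op T" and commute: "L (T x) = T (L x)"
begin

definition act :: "int \<times> nat \<Rightarrow> 'a \<Rightarrow> 'a"
  where "act a x = op_powi T (fst a) ((L ^^ snd a) x)"

lemma unilateral_frame_tuple_iff: "unilateral_frame_tuple T L v \<longleftrightarrow> is_frame (\<lambda>a. act a v)"
  by (simp add: unilateral_frame_tuple_def act_def case_prod_unfold)

lemmas bij_T = invertible_opD(1)[OF invertible_T]

lemma clinear_op_powi: "bounded_clinear (op_powi T k)"
  unfolding op_powi_def
  using bounded_clinear_funpow[OF clinear_T] bounded_clinear_funpow[OF invertible_opD(2)[OF invertible_T]]
  by simp

lemma clinear_act: "bounded_clinear (act a)"
  using bounded_clinear_compose[OF clinear_op_powi bounded_clinear_funpow[OF clinear_L]]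
  by (simp add: act_def[abs_def])

lemma act_zero [simp]: "act (0, 0) x = x"
  by (simp add: act_def)

lemma act_T: "act (1, 0) x = T x"
  by (simp add: act_def op_powi_def)

lemma act_L: "act (0, n) x = (L ^^ n) x"
  by (simp add: act_def)

lemma act_add: "act (a + b) x = act a (act b x)"
proof -
  have "(L ^^ snd a) (T y) = T ((L ^^ snd a) y)" for y
    by (rule funpow_commute[of T L, symmetric]) (rule commute[symmetric])
  then have "(L ^^ snd a) (op_powi T k y) = op_powi T k ((L ^^ snd a) y)" for k y
    by (rule op_powi_commute[OF bij_T])
  then show ?thesis
    by (simp add: act_def op_powi_add[OF bij_T] funpow_add)
qed

lemma act_commute: "act a (act b x) = act b (act a x)"
  by (metis act_add add.commute)

lemma act_intertwine:
  assumes "\<And>x. C (T x) = T (C x)" "\<And>x. C (L x) = L (C x)"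
  shows "C (act a x) = act a (C x)"
  unfolding act_def by (simp only: op_powi_commute[OF bij_T, of C] funpow_commute[of C L] assms)

text \<open>The functional \<open>\<lambda>u. cinner u (dual_op (act m w))\<close> is the dual coefficient at \<open>m\<close>. Since \<open>T\<close> is
  unitary for the dual form, its values at \<open>act (k, b) u\<close>, for varying \<open>k\<close>, are dual coefficients of
  \<open>(L ^^ b) u\<close> in the single row \<open>snd m\<close>, hence lie in the rows below \<open>q = snd m + 1\<close>. The energy in
  these rows is at most the energy that \<open>(L ^^ (b - q)) u\<close> loses under \<open>L ^^ q\<close> when
  \<open>b \<ge> q\<close>, so the sum over \<open>b\<close> telescopes.\<close>
lemma orbit_functional_bound:
  assumes "frame (\<lambda>a. act a w) B A" and "finite F"
  shows "(\<Sum>a\<in>F. (cmod (cinner (act a u) (frame.dual_op (\<lambda>a. act a w) (act m w))))\<^sup>2)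
    \<le> 2 * real (snd m + 1) * frame.energy (\<lambda>a. act a w) u"
proof -
  interpret frame "\<lambda>a. act a w" B A by fact
  define q where "q = snd m + 1"
  \<comment> \<open>\<open>L ^^ n\<close> acts on the orbit of \<open>w\<close> as the index shift \<open>s n\<close>; the range of \<open>s q\<close> misses
    exactly the rows below \<open>q\<close>.\<close>
  define s :: "nat \<Rightarrow> int \<times> nat \<Rightarrow> int \<times> nat" where "s n a = a + (0, n)" for n a
  have s: "inj (s n)" for n unfolding s_def by (rule injI) simp
  have sL: "(L ^^ n) (act a w) = act (s n a) w" for n a
    unfolding s_def act_L[symmetric] by (simp add: act_add[symmetric] add.commute)
  define f where "f b = energy ((L ^^ b) u)" for b
  define g where "g b = (\<Sum>\<^sub>\<infinity>i\<in>- range (s q). (cmod (dual_coeff ((L ^^ b) u) i))\<^sup>2)" for b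
  have summ: "(\<lambda>i. (cmod (dual_coeff x i))\<^sup>2) summable_on S" for x S
    using dual_coeff_summable by (rule summable_on_subset_banach) simp
  have coeff: "cinner (act (k, b) u) (dual_op (act m w))
      = dual_coeff ((L ^^ b) u) (fst m - k, snd m)" for k b
  proof -
    have m: "act m w = act (k, 0) (act (fst m - k, snd m) w)"
      by (simp flip: act_add)
    have u: "act (k, b) u = act (k, 0) ((L ^^ b) u)"
      by (simp flip: act_add act_L)
    have "cinner (act (k, b) u) (dual_op (act m w)) = cinner (dual_op (act (k, b) u)) (act m w)"
      by (simp add: cinner_dual_op)
    also have "\<dots> = cinner (dual_op ((L ^^ b) u)) (act (fst m - k, snd m) w)"
      unfolding m u
    proof (rule dual_form_invariant[OF clinear_act, where p = "\<lambda>a. (k, 0) + a"])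
      show "inj (act (k, 0))"
        by (rule inj_on_inverseI[where g = "act (- k, 0)"]) (simp flip: act_add)
      show "bij (\<lambda>a. (k, 0::nat) + a)"
        by (rule bij_betw_byWitness[where f' = "\<lambda>a. (- k, 0) + a"])
          (auto simp: add.assoc[symmetric] simp flip: zero_prod_def)
      show "act (k, 0) (act i w) = act ((k, 0) + i) w" for i
        by (simp add: act_add)
    qed
    finally show ?thesis by (simp add: dual_coeff_def)
  qed
  have row: "(\<Sum>k\<in>K. (cmod (cinner (act (k, b) u) (dual_op (act m w))))\<^sup>2) \<le> g b"
    if "finite K" for K b
  proof -
    have "(\<Sum>k\<in>K. (cmod (cinner (act (k, b) u) (dual_op (act m w))))\<^sup>2)
        = (\<Sum>i\<in>(\<lambda>k. (fst m - k, snd m)) ` K. (cmod (dual_coeff ((L ^^ b) u) i))\<^sup>2)"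
      by (subst sum.reindex) (auto simp: inj_on_def coeff)
    also have "\<dots> \<le> g b"
      unfolding g_def using that
      by (intro finite_sum_le_infsum summ) (auto simp: s_def q_def)
    finally show ?thesis .
  qed
  have energy_L: "energy (L x) \<le> energy x" for x
  proof -
    have "0 \<le> (\<Sum>\<^sub>\<infinity>i\<in>- range (s 1). (cmod (dual_coeff (L x) i))\<^sup>2)"
      by (rule infsum_nonneg) simp
    also have "\<dots> \<le> energy x - energy (L x)"
      using sL[of 1] by (intro energy_outside_shift_le clinear_L s) simp
    finally show ?thesis by simp
  qed
  have f_le: "f b \<le> energy u" for b
    by (induction b) (auto simp: f_def intro: order_trans[OF energy_L])
  obtain N where N: "snd ` F \<subseteq> {..<N}"
    using finite_nat_iff_bounded[of "snd ` F"] assms(2) by auto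
  define h where "h k b = (cmod (cinner (act (k, b) u) (dual_op (act m w))))\<^sup>2" for k b
  have "(\<Sum>a\<in>F. (cmod (cinner (act a u) (dual_op (act m w))))\<^sup>2) = (\<Sum>(k, b)\<in>F. h k b)"
    by (simp add: h_def case_prod_unfold)
  also have "\<dots> \<le> (\<Sum>(k, b)\<in>fst ` F \<times> {..<N + q}. h k b)"
    using assms(2) N by (intro sum_mono2) (force simp: image_subset_iff h_def)+
  also have "\<dots> = (\<Sum>b<N + q. \<Sum>k\<in>fst ` F. h k b)"
    by (simp only: sum.cartesian_product[symmetric] sum.swap[of _ "fst ` F"])
  also have "\<dots> \<le> (\<Sum>b<N + q. g b)"
    unfolding h_def by (intro sum_mono row) (simp add: assms(2))
  also have "\<dots> \<le> 2 * (\<Sum>b<q. f b)"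
  proof (rule sum_le_of_telescoping_bound)
    show "g b \<le> f b" for b
      unfolding g_def f_def energy_def by (intro infsum_mono_neutral summ) auto
    show "g (b + q) \<le> f b - f (b + q)" for b
      using energy_outside_shift_le[OF bounded_clinear_funpow[OF clinear_L] s sL, of q "(L ^^ b) u"]
      by (simp add: g_def f_def add.commute[of b] funpow_add)
    show "0 \<le> f b" for b by (simp add: f_def energy_nonneg)
  qed
  also have "\<dots> \<le> 2 * (\<Sum>b<q. energy u)"
    by (intro mult_left_mono sum_mono f_le) simp
  also have "\<dots> = 2 * real (snd m + 1) * energy u" by (simp add: q_def)
  finally show ?thesis .
qed

text \<open>If \<open>v\<close> were a finite combination of orbit vectors of \<open>w\<close>, a dependency of the orbit of \<open>w\<close>
  would be inherited by \<open>v\<close> by commutativity. In general the expansion of \<open>v\<close> is infinite, and the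
  assignment of \<open>act a v\<close> to \<open>act a w\<close>, extended to finite combinations, is not known to be bounded.
  By the preceding bound it is continuous after pairing with each vector \<open>dual_op (act m w)\<close>. These
  vectors separate points, so the assignment is closable, which suffices.\<close>
lemma orbit_dependency_inherited:
  assumes "frame (\<lambda>a. act a w) B A" and "bessel (\<lambda>a. act a v) D"
    and c: "square_summable c" and c0: "synthesis (\<lambda>a. act a w) c = 0"
  shows "synthesis (\<lambda>a. act a v) c = 0"
proof -
  interpret frame "\<lambda>a. act a w" B A by fact
  interpret v: bessel "\<lambda>a. act a v" D by fact
  define y where "y = synthesis (\<lambda>a. act a v) c"
  have "cinner y (dual_op (act m w)) = 0" for m
  proof -
    define K where "K = sqrt (energy v * (2 * real (snd m + 1) * (B / A\<^sup>2)))"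
    have K_nonneg: "0 \<le> energy v * (2 * real (snd m + 1) * (B / A\<^sup>2))"
      using energy_nonneg B_pos by simp
    have bound: "cmod (\<Sum>i\<in>F. cinner (c i *\<^sub>C act i v) (dual_op (act m w)))
        \<le> K * norm (\<Sum>i\<in>F. c i *\<^sub>C act i w)" (is "_ \<le> K * norm ?u") if F: "finite F" for F
    proof -
      \<comment> \<open>\<open>P\<close> commutes with the orbit operators, so the expansion of \<open>v\<close> in the orbit of \<open>w\<close>
        becomes an expansion of \<open>P v\<close> in the orbit of \<open>P w\<close>, which is small.\<close>
      define P where "P x = (\<Sum>i\<in>F. c i *\<^sub>C act i x)" for x
      have P_linear: "bounded_linear P"
        unfolding P_def
        by (intro bounded_linear_sum bounded_linear_compose[OF
            bounded_clinearD(1)[OF bounded_clinear_scaleC] bounded_clinearD(1)[OF clinear_act]])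
      have "P (d *\<^sub>C x) = d *\<^sub>C P x" for d x
      proof -
        have "d *\<^sub>C P x = (\<Sum>i\<in>F. c i *\<^sub>C d *\<^sub>C act i x)"
          unfolding P_def by (rule bounded_clinear_sum[OF bounded_clinear_scaleC])
        then show ?thesis by (simp add: P_def bounded_clinearD(2)[OF clinear_act])
      qed
      with P_linear have P: "bounded_clinear P" by (simp add: bounded_clinear_def)
      have P_act: "P (act a w) = act a ?u" for a
        unfolding P_def bounded_clinear_sum[OF clinear_act] by (simp add: act_commute[of a])
      have "((\<lambda>a. dual_coeff v a *\<^sub>C act a ?u) has_sum P v) UNIV"
        using synthesis_map_has_sum[OF dual_coeff_summable P, of v] by (simp add: P_act)
      from has_sum_bounded_linear[OF bounded_linear_cinner_left[of "dual_op (act m w)"] this]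
      have "((\<lambda>a. dual_coeff v a * cinner (act a ?u) (dual_op (act m w))) has_sum
          cinner (P v) (dual_op (act m w))) UNIV"
        by (simp add: cinner_scaleC_left)
      then have "cmod (cinner (P v) (dual_op (act m w))) \<le> K * norm ?u"
      proof (rule has_sum_norm_le)
        fix G :: "(int \<times> nat) set" assume G: "finite G"
        have "(cmod (\<Sum>a\<in>G. dual_coeff v a * cinner (act a ?u) (dual_op (act m w))))\<^sup>2
            \<le> (\<Sum>a\<in>G. (cmod (dual_coeff v a))\<^sup>2)
              * (\<Sum>a\<in>G. (cmod (cinner (act a ?u) (dual_op (act m w))))\<^sup>2)"
          by (rule finite_Cauchy_Schwarz)
        also have "\<dots> \<le> energy v * (2 * real (snd m + 1) * (B / A\<^sup>2 * (norm ?u)\<^sup>2))"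
        proof (intro mult_mono energy_nonneg sum_nonneg)
          show "(\<Sum>a\<in>G. (cmod (dual_coeff v a))\<^sup>2) \<le> energy v"
            unfolding energy_def by (rule sum_cmod_le_sq_norm[OF dual_coeff_summable G])
          have "(\<Sum>a\<in>G. (cmod (cinner (act a ?u) (dual_op (act m w))))\<^sup>2)
              \<le> 2 * real (snd m + 1) * energy ?u"
            by (rule orbit_functional_bound[OF assms(1) G])
          also have "\<dots> \<le> 2 * real (snd m + 1) * (B / A\<^sup>2 * (norm ?u)\<^sup>2)"
            by (intro mult_left_mono energy_le) simp
          finally show "(\<Sum>a\<in>G. (cmod (cinner (act a ?u) (dual_op (act m w))))\<^sup>2)
              \<le> 2 * real (snd m + 1) * (B / A\<^sup>2 * (norm ?u)\<^sup>2)" .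
        qed simp
        also have "\<dots> = (K * norm ?u)\<^sup>2"
          unfolding K_def power_mult_distrib real_sqrt_pow2[OF K_nonneg] by (simp add: mult_ac)
        finally show "cmod (\<Sum>a\<in>G. dual_coeff v a * cinner (act a ?u) (dual_op (act m w)))
            \<le> K * norm ?u"
          by (rule power2_le_imp_le) (use K_nonneg in \<open>simp add: K_def\<close>)
      qed
      then show ?thesis by (simp add: P_def cinner_sum_left)
    qed
    have "((\<lambda>F. \<Sum>i\<in>F. c i *\<^sub>C act i w) \<longlongrightarrow> 0) (finite_subsets_at_top UNIV)"
      using synthesis_has_sum[OF c] c0 by (simp add: has_sum_def)
    then have "((\<lambda>F. K * norm (\<Sum>i\<in>F. c i *\<^sub>C act i w)) \<longlongrightarrow> 0) (finite_subsets_at_top UNIV)"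
      by (intro tendsto_mult_right_zero tendsto_norm_zero)
    then have "((\<lambda>F. \<Sum>i\<in>F. cinner (c i *\<^sub>C act i v) (dual_op (act m w))) \<longlongrightarrow> 0)
        (finite_subsets_at_top UNIV)"
      by (rule Lim_null_comparison[rotated])
        (rule eventually_finite_subsets_at_top_weakI, rule bound)
    then have "((\<lambda>i. cinner (c i *\<^sub>C act i v) (dual_op (act m w))) has_sum 0) UNIV"
      by (simp add: has_sum_def)
    moreover have "((\<lambda>i. cinner (c i *\<^sub>C act i v) (dual_op (act m w))) has_sum
        cinner y (dual_op (act m w))) UNIV"
      unfolding y_def
      by (rule has_sum_bounded_linear[OF bounded_linear_cinner_left v.synthesis_has_sum[OF c]])
    ultimately have "0 = cinner y (dual_op (act m w))" by (rule has_sum_unique)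
    then show ?thesis by simp
  qed
  then have "dual_op y = 0"
    by (intro eq_0_of_orthogonal_frame) (simp add: cinner_dual_op)
  then have "y = 0"
    using frame_op_dual_op[of y] linear_0[OF frame_op_linear] by simp
  then show ?thesis by (simp add: y_def)
qed

lemma orbit_operator:
  assumes "frame (\<lambda>a. act a w) B A" and "bessel (\<lambda>a. act a v) D"
  shows "\<exists>C. bounded_clinear C \<and> (\<forall>a. C (act a w) = act a v)"
proof (rule frame.operator_of_kernel_inclusion[OF assms])
  fix c :: "int \<times> nat \<Rightarrow> complex"
  assume "square_summable c" "synthesis (\<lambda>a. act a w) c = 0"
  then show "synthesis (\<lambda>a. act a v) c = 0" by (rule orbit_dependency_inherited[OF assms])
qed

text \<open>The operators obtained from the two orbits in either direction are mutually inverse, since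
  their composites fix a spanning orbit.\<close>
lemma invertible_of_frame_tuples:
  assumes "unilateral_frame_tuple T L w" "unilateral_frame_tuple T L v"
  shows "\<exists>C. bounded_clinear C \<and> invertible_op C \<and> C \<circ> T = T \<circ> C \<and> C \<circ> L = L \<circ> C \<and> C w = v"
proof -
  obtain B A where w: "frame (\<lambda>a. act a w) B A"
    using assms(1) by (auto simp: unilateral_frame_tuple_iff is_frame_iff)
  obtain B' A' where v: "frame (\<lambda>a. act a v) B' A'"
    using assms(2) by (auto simp: unilateral_frame_tuple_iff is_frame_iff)
  obtain C where C: "bounded_clinear C" "\<And>a. C (act a w) = act a v"
    using orbit_operator[OF w frame.axioms(1)[OF v]] by blast
  obtain D where D: "bounded_clinear D" "\<And>a. D (act a v) = act a w"
    using orbit_operator[OF v frame.axioms(1)[OF w]] by blast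
  have id: "bounded_clinear (\<lambda>x. x)"
    by (simp add: bounded_clinear_def bounded_linear_ident)
  have "(\<lambda>x. D (C x)) = (\<lambda>x. x)"
    using frame.eq_on_frame_vectors[OF w bounded_clinear_compose[OF D(1) C(1)] id]
    by (simp add: C D)
  moreover have "(\<lambda>x. C (D x)) = (\<lambda>x. x)"
    using frame.eq_on_frame_vectors[OF v bounded_clinear_compose[OF C(1) D(1)] id]
    by (simp add: C D)
  ultimately have "invertible_op C"
    using D(1) unfolding invertible_op_def by (intro exI[of _ D]) (simp add: o_def id_def)
  have CT: "(\<lambda>x. C (act b x)) = (\<lambda>x. act b (C x))" for b
  proof (rule frame.eq_on_frame_vectors[OF w])
    show "C (act b (act a w)) = act b (C (act a w))" for a
      by (simp add: C(2) flip: act_add)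
  qed (rule bounded_clinear_compose[OF C(1) clinear_act],
      rule bounded_clinear_compose[OF clinear_act C(1)])
  have "C \<circ> T = T \<circ> C"
    using CT[of "(1, 0)"] by (simp add: act_T o_def)
  moreover have "C \<circ> L = L \<circ> C"
    using CT[of "(0, 1)"] by (simp add: act_L o_def)
  moreover have "C w = v"
    using C(2)[of "(0, 0)"] by simp
  ultimately show ?thesis using C(1) \<open>invertible_op C\<close> by blast
qed

end

section \<open>Generators of unilateral frames\<close>

theorem theorem4p1:
  fixes T L :: "'a::complex_hilbert_space \<Rightarrow> 'a" and w :: 'a
  assumes "separable_space (euclidean :: 'a topology)"
    and "bounded_clinear T" and "bounded_clinear L"
    and "invertible_op T"
    and "L \<circ> T = T \<circ> L"
    and "w \<in> frame_vectors T L"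
  shows "(\<forall>v. v \<in> frame_vectors T L \<longleftrightarrow> similar_tuples T L v T L w) \<and>
         frame_vectors T L =
           {B w | B. bounded_clinear B \<and> invertible_op B \<and> B \<circ> T = T \<circ> B \<and> B \<circ> L = L \<circ> B}"
    (is "_ \<and> _ = ?R")
proof -
  interpret commuting_pair T L
    using assms(2-5) by unfold_locales (simp_all add: fun_eq_iff)
  have frame_imp_image: "v \<in> ?R" if "v \<in> frame_vectors T L" for v
    using invertible_of_frame_tuples[of w v] that assms(6) unfolding frame_vectors_def by blast
  have image_imp_similar: "similar_tuples T L v T L w" if R: "v \<in> ?R" for v
  proof -
    obtain B where B: "bounded_clinear B" "invertible_op B" "B \<circ> T = T \<circ> B" "B \<circ> L = L \<circ> B" "v = B w"
      using R by blast
    note bij = invertible_opD(1)[OF B(2)]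
    have "T \<circ> inv B = inv B \<circ> T" "L \<circ> inv B = inv B \<circ> L"
      using commute_inv[OF bij B(3)] commute_inv[OF bij B(4)] by (simp_all add: fun_eq_iff)
    moreover have "inv B v = w" using bij B(5) by (simp add: bij_is_inj)
    ultimately show ?thesis
      unfolding similar_tuples_def
      by (intro exI[of _ "inv B"] conjI invertible_opD(2)[OF B(2)] bij_imp_bij_inv[OF bij])
  qed
  have similar_imp_frame: "v \<in> frame_vectors T L" if sim: "similar_tuples T L v T L w" for v
  proof -
    obtain C where C: "bounded_clinear C" "bij C" "C v = w" "T \<circ> C = C \<circ> T" "L \<circ> C = C \<circ> L"
      using sim unfolding similar_tuples_def by blast
    have comm: "inv C (T x) = T (inv C x)" "inv C (L x) = L (inv C x)" for x
      by (rule commute_inv[OF C(2) C(4)[symmetric]], rule commute_inv[OF C(2) C(5)[symmetric]])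
    have "inv C w = v" using C(2,3) by (intro inv_f_eq) (simp_all add: bij_is_inj)
    then have "(\<lambda>a. act a v) = (\<lambda>a. inv C (act a w))"
      using act_intertwine[of "inv C", OF comm] by simp
    moreover obtain B A where w: "frame (\<lambda>a. act a w) B A"
      using assms(6) unfolding frame_vectors_def unilateral_frame_tuple_iff is_frame_iff by blast
    have "is_frame (\<lambda>a. inv C (act a w))"
      by (rule frame.is_frame_image[OF w bounded_clinear_inv[OF C(1,2)] C(1)])
        (simp add: C(2) bij_is_inj)
    ultimately show ?thesis
      by (simp add: frame_vectors_def unilateral_frame_tuple_iff)
  qed
  show ?thesis
  proof (intro conjI allI iffI set_eqI)
    show "similar_tuples T L v T L w" if "v \<in> frame_vectors T L" for v
      by (rule image_imp_similar[OF frame_imp_image[OF that]])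
    show "v \<in> frame_vectors T L" if "v \<in> ?R" for v
      by (rule similar_imp_frame[OF image_imp_similar[OF that]])
  qed (fact similar_imp_frame frame_imp_image)+
qed

end
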